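(* For real $x\ge 1$, let $\mathfrak{n}$ and $\mathfrak{m}$ be nonzero ideals chosen independently and uniformly at random from the (finite) set of nonzero ideals of $\mathbb{Z}[i]$ with norm $x$ or less. Then the expected value of the norm $N((\mathfrak{n},\mathfrak{m}))$ of the greatest common divisor of $\mathfrak{n}$ and $\mathfrak{m}$ is $$\frac{\pi}{4\,\zeta_{\mathbb{Q}(i)}(2)}\log x + O(1)$$ as $x\to\infty$.
   Context: For a Gaussian integer $\alpha=a+bi$ with $a,b\in\mathbb{Z}$, the norm is $N(\alpha)=a^2+b^2$. Every ideal $\mathfrak{n}$ of $\mathbb{Z}[i]$ is principal, $\mathfrak{n}=(\eta)$, and its norm is $N(\mathfrak{n})=N(\eta)$. The greatest common divisor $(\mathfrak{n},\mathfrak{m})$ of two ideals is the smallest ideal containing both, i.e. the ideal $\mathfrak{K}$ with $\mathfrak{n}\subset\mathfrak{K}$, $\mathfrak{m}\subset\mathfrak{K}$, and such that $\mathfrak{K}\subset\mathfrak{a}$ for every ideal $\mathfrak{a}$ containing both $\mathfrak{n}$ and $\mathfrak{m}$. The Dedekind zeta function of $\mathbb{Q}(i)$ is, for $\mathrm{Re}(s)>1$, $\zeta_{\mathbb{Q}(i)}(s)=\sum_{\mathfrak{a}} N(\mathfrak{a})^{-s}$, summed over nonzero ideals $\mathfrak{a}$ of $\mathbb{Z}[i]$; equivalently $\frac14\sum_{(a,b)\in\mathbb{Z}^2\setminus\{(0,0)\}}(a^2+b^2)^{-s}$. *)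

theory Defs
  imports
    "HOL-Algebra.Ideal"
    "HOL-Probability.Probability"
    "HOL-Library.Landau_Symbols"
begin

definition gauss_ring :: "complex ring" where
  "gauss_ring =
     \<lparr>carrier = {of_int a + \<i> * of_int b | a b. True},
      monoid.mult = (*), one = 1, zero = 0, add = (+)\<rparr>"

definition gauss_norm :: "complex \<Rightarrow> real" where
  "gauss_norm z = (Re z)\<^sup>2 + (Im z)\<^sup>2"

definition nonzero_ideals :: "complex set set" where
  "nonzero_ideals = {I. ideal I gauss_ring \<and> I \<noteq> {0}}"

text \<open>
  The description is well defined, see \<open>ideal_norm_PIdl\<close> below: generators of the same
  ideal have the same norm, and every ideal of the Gaussian integers is principal.
\<close>
definition ideal_norm :: "complex set \<Rightarrow> real" where
  "ideal_norm I =
     (THE r. \<exists>\<eta>\<in>carrier gauss_ring. I = PIdl\<^bsub>gauss_ring\<^esub> \<eta> \<and> r = gauss_norm \<eta>)"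

definition ideal_gcd :: "complex set \<Rightarrow> complex set \<Rightarrow> complex set" where
  "ideal_gcd I J = Idl\<^bsub>gauss_ring\<^esub> (I \<union> J)"

definition ideals_upto :: "real \<Rightarrow> complex set set" where
  "ideals_upto x = {I \<in> nonzero_ideals. ideal_norm I \<le> x}"

text \<open>
  Only meaningful for \<open>Re s > 1\<close>, where the series converges absolutely; an infinite sum that
  does not converge has the value 0.
\<close>
definition zeta_Qi :: "complex \<Rightarrow> complex" where
  "zeta_Qi s = (\<Sum>\<^sub>\<infinity>I\<in>nonzero_ideals. of_real (ideal_norm I) powr (- s))"

text \<open>
  The pair is drawn from the product of two uniform distributions, so its components are
  independent.  For \<open>x \<ge> 1\<close> the set of ideals is finite and nonempty.
\<close>
definition expected_gcd_norm :: "real \<Rightarrow> real" where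
  "expected_gcd_norm x =
     measure_pmf.expectation (pair_pmf (pmf_of_set (ideals_upto x)) (pmf_of_set (ideals_upto x)))
       (\<lambda>(I, J). ideal_norm (ideal_gcd I J))"

lemma gauss_ringI: "z = of_int a + \<i> * of_int b \<Longrightarrow> z \<in> carrier gauss_ring"
  by (auto simp: gauss_ring_def)

lemma cring_gauss_ring: "cring gauss_ring"
proof (rule cringI)
  show "abelian_group gauss_ring"
  proof (rule abelian_groupI)
    fix x y assume "x \<in> carrier gauss_ring" "y \<in> carrier gauss_ring"
    then obtain a b c d :: int where "x = of_int a + \<i> * of_int b" "y = of_int c + \<i> * of_int d"
      by (auto simp: gauss_ring_def)
    then have "x + y = of_int (a + c) + \<i> * of_int (b + d)"
      by (simp add: algebra_simps)
    from gauss_ringI[OF this] show "x \<oplus>\<^bsub>gauss_ring\<^esub> y \<in> carrier gauss_ring"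
      by (simp add: gauss_ring_def)
  next
    show "\<zero>\<^bsub>gauss_ring\<^esub> \<in> carrier gauss_ring"
      by (auto simp: gauss_ring_def intro: exI[of _ 0])
  next
    fix x assume "x \<in> carrier gauss_ring"
    then obtain a b :: int where "x = of_int a + \<i> * of_int b"
      by (auto simp: gauss_ring_def)
    then have "(of_int (- a) + \<i> * of_int (- b)) + x = 0"
      by simp
    with gauss_ringI[OF refl, of "- a" "- b"] show "\<exists>y\<in>carrier gauss_ring. y \<oplus>\<^bsub>gauss_ring\<^esub> x = \<zero>\<^bsub>gauss_ring\<^esub>"
      by (intro bexI[of _ "of_int (- a) + \<i> * of_int (- b)"]) (auto simp: gauss_ring_def)
  qed (auto simp: gauss_ring_def)
next
  show "comm_monoid gauss_ring"
  proof (rule comm_monoidI)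
    fix x y assume "x \<in> carrier gauss_ring" "y \<in> carrier gauss_ring"
    then obtain a b c d :: int where "x = of_int a + \<i> * of_int b" "y = of_int c + \<i> * of_int d"
      by (auto simp: gauss_ring_def)
    then have "x * y = of_int (a * c - b * d) + \<i> * of_int (a * d + b * c)"
      by (simp add: complex_eq_iff)
    from gauss_ringI[OF this] show "x \<otimes>\<^bsub>gauss_ring\<^esub> y \<in> carrier gauss_ring"
      by (simp add: gauss_ring_def)
  next
    have "(1::complex) = of_int 1 + \<i> * of_int 0" by simp
    from gauss_ringI[OF this] show "\<one>\<^bsub>gauss_ring\<^esub> \<in> carrier gauss_ring"
      by (simp add: gauss_ring_def)
  qed (auto simp: gauss_ring_def)
qed (auto simp: gauss_ring_def algebra_simps)

lemma gauss_norm_mult: "gauss_norm (x * y) = gauss_norm x * gauss_norm y"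
  by (simp add: gauss_norm_def power2_eq_square algebra_simps)

lemma gauss_norm_le_of_PIdl_eq:
  assumes x: "x \<in> carrier gauss_ring" and y: "y \<in> carrier gauss_ring"
    and eq: "PIdl\<^bsub>gauss_ring\<^esub> x = PIdl\<^bsub>gauss_ring\<^esub> y"
  shows "gauss_norm x \<le> gauss_norm y"
proof (cases "y = 0")
  case True
  have "x \<in> PIdl\<^bsub>gauss_ring\<^esub> y"
    using ring.cgenideal_self[OF cring.axioms(1)[OF cring_gauss_ring] x] eq by simp
  with True have "x = 0"
    by (auto simp: cgenideal_def gauss_ring_def)
  with True show ?thesis by simp
next
  case False
  have "y \<in> PIdl\<^bsub>gauss_ring\<^esub> x"
    using ring.cgenideal_self[OF cring.axioms(1)[OF cring_gauss_ring] y] eq by simp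
  then obtain z where z: "z \<in> carrier gauss_ring" "y = z * x"
    by (auto simp: cgenideal_def gauss_ring_def)
  then obtain a b :: int where ab: "z = of_int a + \<i> * of_int b"
    by (auto simp: gauss_ring_def)
  have "gauss_norm z = of_int (a\<^sup>2 + b\<^sup>2)"
    by (simp add: ab gauss_norm_def)
  moreover have "a\<^sup>2 + b\<^sup>2 > 0"
    using False z ab by (auto simp: sum_power2_gt_zero_iff)
  ultimately have "gauss_norm z \<ge> 1"
    by (smt (verit) of_int_1_le_iff)
  moreover have "gauss_norm x \<ge> 0" by (simp add: gauss_norm_def)
  ultimately show ?thesis
    using mult_right_mono[of 1 "gauss_norm z" "gauss_norm x"] by (simp add: z gauss_norm_mult)
qed

lemma ideal_norm_PIdl:
  assumes "\<eta> \<in> carrier gauss_ring"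
  shows "ideal_norm (PIdl\<^bsub>gauss_ring\<^esub> \<eta>) = gauss_norm \<eta>"
  unfolding ideal_norm_def
  by (rule the_equality) (use assms in \<open>auto intro: antisym gauss_norm_le_of_PIdl_eq\<close>)

end

theory Submission
  imports Defs
begin

text \<open>
  Write \<open>A(x)\<close> for the number of nonzero ideals of norm at most \<open>x\<close> and \<open>S(x)\<close> for the sum of
  \<open>N(gcd(I, J))\<close> over all pairs of such ideals.  The map
  \<open>(E, I, J) \<mapsto> (D, E I / D, E J / D)\<close> with \<open>D = gcd(I, J)\<close> is an involution on the triples with
  \<open>N(E) N(I), N(E) N(J) \<le> x\<close>, and it exchanges \<open>N(gcd(I, J))\<close> with \<open>N(E)\<close>.  Hence
  \<open>\<Sum> S(x / N(E)) = \<Sum> N(E) A(x / N(E))\<^sup>2\<close>, both sums over \<open>N(E) \<le> x\<close>, and the lattice point count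
  \<open>A(x) = (\<pi>/4) x + O(\<surd>x)\<close> evaluates the right-hand side as \<open>(\<pi>/4)^3 x\<^sup>2 ln x + O(x\<^sup>2)\<close>.
  After division by \<open>x\<^sup>2\<close> the left-hand side is a convolution with the weights \<open>N(E)^-2\<close>, whose total
  \<open>\<zeta>(2)\<close> is less than 2; the weight 1 of the unit ideal therefore dominates the others, and
  the convolution can be inverted up to a bounded error by a contraction argument.
\<close>

subsection \<open>Ideals of the Gaussian integers\<close>

abbreviation "gauss_int \<equiv> carrier gauss_ring"

abbreviation gauss_PIdl :: "complex \<Rightarrow> complex set" where
  "gauss_PIdl \<equiv> cgenideal gauss_ring"

lemma gauss_int_iff: "z \<in> gauss_int \<longleftrightarrow> Re z \<in> \<int> \<and> Im z \<in> \<int>"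
proof
  assume "Re z \<in> \<int> \<and> Im z \<in> \<int>"
  then obtain a b :: int where "Re z = of_int a" "Im z = of_int b"
    by (auto elim!: Ints_cases)
  then show "z \<in> gauss_int"
    by (intro gauss_ringI[of z a b]) (simp add: complex_eq_iff)
qed (auto simp: gauss_ring_def)

lemma gauss_int_simps [simp]:
  "0 \<in> gauss_int" "1 \<in> gauss_int" "\<i> \<in> gauss_int"
  "a \<in> gauss_int \<Longrightarrow> - a \<in> gauss_int"
  "a \<in> gauss_int \<Longrightarrow> b \<in> gauss_int \<Longrightarrow> a + b \<in> gauss_int"
  "a \<in> gauss_int \<Longrightarrow> b \<in> gauss_int \<Longrightarrow> a - b \<in> gauss_int"
  "a \<in> gauss_int \<Longrightarrow> b \<in> gauss_int \<Longrightarrow> a * b \<in> gauss_int"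
  by (auto simp: gauss_int_iff)

lemma gauss_ring_simps:
  "x \<oplus>\<^bsub>gauss_ring\<^esub> y = x + y" "x \<otimes>\<^bsub>gauss_ring\<^esub> y = x * y"
  "\<zero>\<^bsub>gauss_ring\<^esub> = 0" "\<one>\<^bsub>gauss_ring\<^esub> = 1"
  by (simp_all add: gauss_ring_def)

lemma gauss_PIdl_iff: "a \<in> gauss_PIdl b \<longleftrightarrow> (\<exists>w\<in>gauss_int. a = w * b)"
  by (auto simp: cgenideal_def gauss_ring_simps)

lemma gauss_PIdl_0: "gauss_PIdl 0 = {0}"
proof -
  have "\<exists>w. w \<in> gauss_int" using gauss_int_simps(1) by blast
  then show ?thesis by (auto simp: gauss_PIdl_iff)
qed

lemma gauss_PIdl_self [simp]: "a \<in> gauss_PIdl a"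
  unfolding gauss_PIdl_iff by (rule bexI[of _ 1]) auto

lemma gauss_PIdl_subset_iff: "gauss_PIdl a \<subseteq> gauss_PIdl b \<longleftrightarrow> a \<in> gauss_PIdl b"
proof
  assume "a \<in> gauss_PIdl b"
  then obtain w where w: "w \<in> gauss_int" "a = w * b" by (auto simp: gauss_PIdl_iff)
  show "gauss_PIdl a \<subseteq> gauss_PIdl b"
  proof
    fix z assume "z \<in> gauss_PIdl a"
    then obtain v where "v \<in> gauss_int" "z = v * a" by (auto simp: gauss_PIdl_iff)
    then have "z = (v * w) * b" "v * w \<in> gauss_int" using w by auto
    then show "z \<in> gauss_PIdl b" unfolding gauss_PIdl_iff by blast
  qed
qed (use gauss_PIdl_self in blast)

lemma gauss_PIdl_eq_iff: "gauss_PIdl a = gauss_PIdl b \<longleftrightarrow> a \<in> gauss_PIdl b \<and> b \<in> gauss_PIdl a"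
  by (metis gauss_PIdl_subset_iff subset_antisym equalityD1 equalityD2)

lemma gauss_PIdl_mult_mem_iff:
  "z \<noteq> 0 \<Longrightarrow> z * a \<in> gauss_PIdl (z * b) \<longleftrightarrow> a \<in> gauss_PIdl b"
  unfolding gauss_PIdl_iff by (auto simp: algebra_simps)

lemma gauss_PIdl_mult_cancel:
  "z \<noteq> 0 \<Longrightarrow> gauss_PIdl (z * a) = gauss_PIdl (z * b) \<longleftrightarrow> gauss_PIdl a = gauss_PIdl b"
  by (simp add: gauss_PIdl_eq_iff gauss_PIdl_mult_mem_iff)

lemma gauss_PIdl_mult_cong:
  assumes "gauss_PIdl a = gauss_PIdl a'" "gauss_PIdl b = gauss_PIdl b'"
  shows "gauss_PIdl (a * b) = gauss_PIdl (a' * b')"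
proof -
  have *: "x * y \<in> gauss_PIdl (x' * y')" if xy: "x \<in> gauss_PIdl x'" "y \<in> gauss_PIdl y'" for x y x' y'
  proof -
    obtain v w where "v \<in> gauss_int" "w \<in> gauss_int" "x = v * x'" "y = w * y'"
      using xy by (auto simp: gauss_PIdl_iff)
    then show ?thesis
      unfolding gauss_PIdl_iff by (intro bexI[of _ "v * w"]) auto
  qed
  show ?thesis using assms by (auto simp: gauss_PIdl_eq_iff intro: *)
qed

lemma gauss_PIdl_eq_0_iff [simp]: "gauss_PIdl a = {0} \<longleftrightarrow> a = 0"
  using gauss_PIdl_self gauss_PIdl_0 by blast

text \<open>Serves to unfold \<open><+>\<close>, which is defined as \<open>set_mult\<close> in the
  additive monoid.\<close>

lemma add_monoid_gauss_ring_mult: "x \<otimes>\<^bsub>add_monoid gauss_ring\<^esub> y = x + y"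
  by (simp add: gauss_ring_def)

lemma gauss_PIdl_eq_Collect: "gauss_PIdl a = {w * a | w. w \<in> gauss_int}"
  by (auto simp: gauss_PIdl_iff)

lemma ideal_gauss_PIdl: "a \<in> gauss_int \<Longrightarrow> ideal (gauss_PIdl a) gauss_ring"
  by (rule cring.cgenideal_ideal[OF cring_gauss_ring])

lemma gauss_norm_cmod: "gauss_norm z = (cmod z)\<^sup>2"
  by (simp add: gauss_norm_def cmod_power2)

lemma gauss_norm_Nats: "z \<in> gauss_int \<Longrightarrow> gauss_norm z \<in> \<nat>"
  by (auto simp: gauss_norm_def gauss_int_iff Nats_altdef2)

text \<open>Rounding both coordinates of \<open>a / b\<close> leaves a difference of norm at most
  1/4 + 1/4, and multiplying back by \<open>b\<close> keeps the remainder below the norm of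
  \<open>b\<close>.\<close>

lemma gauss_int_division:
  assumes "b \<noteq> 0"
  obtains q where "q \<in> gauss_int" "gauss_norm (a - q * b) < gauss_norm b"
proof -
  define q where "q = Complex (of_int (round (Re (a / b)))) (of_int (round (Im (a / b))))"
  have r: "\<bar>x - of_int (round x)\<bar>\<^sup>2 \<le> (1/2)\<^sup>2" for x :: real
    using of_int_round_abs_le[of x] by (intro power_mono) (auto simp: abs_minus_commute)
  have "gauss_norm (a / b - q) \<le> 1/2"
    using r[of "Re (a / b)"] r[of "Im (a / b)"]
    by (simp add: gauss_norm_def q_def power2_eq_square)
  moreover have "a - q * b = (a / b - q) * b"
    using assms by (simp add: algebra_simps)
  moreover have "gauss_norm b > 0"
    using assms by (simp add: gauss_norm_cmod)
  ultimately have "gauss_norm (a - q * b) < gauss_norm b"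
    using mult_right_mono[of "gauss_norm (a / b - q)" "1/2" "gauss_norm b"] by (simp add: gauss_norm_mult)
  moreover have "q \<in> gauss_int"
    by (simp add: gauss_int_iff q_def)
  ultimately show ?thesis using that by blast
qed

text \<open>Euclidean argument: a nonzero element of least norm generates the ideal, since dividing
  any other element by it leaves a remainder in the ideal of smaller norm, which must be 0.\<close>

lemma gauss_ideal_principal:
  assumes "ideal I gauss_ring"
  obtains \<eta> where "\<eta> \<in> gauss_int" "I = gauss_PIdl \<eta>"
proof (cases "I \<subseteq> {0}")
  case True
  have "0 \<in> I"
    using additive_subgroup.zero_closed[OF ideal.axioms(1)[OF assms]] by (simp add: gauss_ring_simps)
  with True have "I = gauss_PIdl 0" by (auto simp: gauss_PIdl_0)
  then show ?thesis using that[of 0] by simp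
next
  case False
  then obtain \<xi> where \<xi>: "\<xi> \<in> I - {0}" by blast
  have sub: "I \<subseteq> gauss_int"
    using additive_subgroup.a_subset[OF ideal.axioms(1)[OF assms]] .
  have mult: "w * z \<in> I" if "w \<in> gauss_int" "z \<in> I" for w z
    using ideal.I_l_closed[OF assms that(2,1)] by (simp add: gauss_ring_simps)
  have add: "w + z \<in> I" if "w \<in> I" "z \<in> I" for w z
    using additive_subgroup.a_closed[OF ideal.axioms(1)[OF assms] that] by (simp add: gauss_ring_simps)
  \<comment> \<open>The norm is real-valued, so the well-ordering of the naturals is applied to its
    floor; on Gaussian integers this loses nothing, because their norms are naturals.\<close>
  obtain \<eta> where \<eta>: "\<eta> \<in> I - {0}"
    and min: "\<And>z. z \<in> I - {0} \<Longrightarrow> nat \<lfloor>gauss_norm \<eta>\<rfloor> \<le> nat \<lfloor>gauss_norm z\<rfloor>"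
    using ex_has_least_nat[of "\<lambda>z. z \<in> I - {0}" \<xi> "\<lambda>z. nat \<lfloor>gauss_norm z\<rfloor>"] \<xi> by blast
  have "z \<in> gauss_PIdl \<eta>" if z: "z \<in> I" for z
  proof -
    obtain q where q: "q \<in> gauss_int" "gauss_norm (z - q * \<eta>) < gauss_norm \<eta>"
      using gauss_int_division[of \<eta> z] \<eta> by auto
    have mem: "z - q * \<eta> \<in> I"
      using add[OF z mult[of "- q" \<eta>]] q \<eta> by simp
    have "nat \<lfloor>gauss_norm (z - q * \<eta>)\<rfloor> < nat \<lfloor>gauss_norm \<eta>\<rfloor>"
      using q(2) gauss_norm_Nats[of "z - q * \<eta>"] gauss_norm_Nats[of \<eta>] subsetD[OF sub mem] subsetD[OF sub] \<eta>
      by (metis Diff_iff Nats_cases floor_of_nat nat_int of_nat_less_iff)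
    then have "z - q * \<eta> = 0"
      using min[of "z - q * \<eta>"] mem by (metis Diff_iff singletonD not_less)
    then have "z = q * \<eta>" by simp
    then show ?thesis using q(1) unfolding gauss_PIdl_iff by blast
  qed
  moreover have "gauss_PIdl \<eta> \<subseteq> I"
    using mult \<eta> by (auto simp: gauss_PIdl_iff)
  ultimately show ?thesis using that[of \<eta>] \<eta> sub by blast
qed

lemma nonzero_ideals_eq: "nonzero_ideals = gauss_PIdl ` (gauss_int - {0})"
proof (intro equalityI subsetI)
  fix I assume "I \<in> nonzero_ideals"
  then have I: "ideal I gauss_ring" "I \<noteq> {0}" by (auto simp: nonzero_ideals_def)
  from I(1) obtain \<eta> where "\<eta> \<in> gauss_int" "I = gauss_PIdl \<eta>"
    by (rule gauss_ideal_principal)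
  with I(2) show "I \<in> gauss_PIdl ` (gauss_int - {0})" by (intro image_eqI[of _ _ \<eta>]) auto
next
  fix I assume "I \<in> gauss_PIdl ` (gauss_int - {0})"
  then show "I \<in> nonzero_ideals"
    unfolding nonzero_ideals_def using ideal_gauss_PIdl gauss_PIdl_eq_0_iff by blast
qed

lemma gauss_PIdl_nonzero_ideals: "a \<in> gauss_int \<Longrightarrow> a \<noteq> 0 \<Longrightarrow> gauss_PIdl a \<in> nonzero_ideals"
  by (auto simp: nonzero_ideals_eq)

lemma nonzero_idealsE:
  assumes "I \<in> nonzero_ideals"
  obtains \<eta> where "\<eta> \<in> gauss_int" "\<eta> \<noteq> 0" "I = gauss_PIdl \<eta>"
  using assms by (auto simp: nonzero_ideals_eq)

text \<open>The Bezout identity puts \<open>d\<close> into every ideal containing \<open>a\<close>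
  and \<open>b\<close>; conversely both are multiples of \<open>d\<close>, so the generated ideal
  lies in \<open>(d)\<close>.\<close>

lemma ideal_gcd_PIdl:
  assumes ab: "a \<in> gauss_int" "b \<in> gauss_int" and "r \<in> gauss_int" "s \<in> gauss_int"
    and d: "d = r * a + s * b" "a \<in> gauss_PIdl d" "b \<in> gauss_PIdl d"
  shows "ideal_gcd (gauss_PIdl a) (gauss_PIdl b) = gauss_PIdl d"
proof -
  have dG: "d \<in> gauss_int" unfolding d(1) using assms(1-4) by simp
  interpret cring gauss_ring by (rule cring_gauss_ring)
  let ?U = "gauss_PIdl a \<union> gauss_PIdl b"
  have U: "?U \<subseteq> gauss_int" using ab unfolding gauss_PIdl_eq_Collect by auto
  have idl: "ideal (Idl\<^bsub>gauss_ring\<^esub> ?U) gauss_ring" by (rule genideal_ideal[OF U])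
  have "a \<in> Idl\<^bsub>gauss_ring\<^esub> ?U" "b \<in> Idl\<^bsub>gauss_ring\<^esub> ?U"
    using genideal_self[OF U] gauss_PIdl_self by blast+
  then have "r * a \<in> Idl\<^bsub>gauss_ring\<^esub> ?U" "s * b \<in> Idl\<^bsub>gauss_ring\<^esub> ?U"
    using ideal.I_l_closed[OF idl, unfolded gauss_ring_simps] assms(3,4) by blast+
  then have "d \<in> Idl\<^bsub>gauss_ring\<^esub> ?U"
    using additive_subgroup.a_closed[OF ideal.axioms(1)[OF idl], unfolded gauss_ring_simps] d(1) by blast
  then have "gauss_PIdl d \<subseteq> Idl\<^bsub>gauss_ring\<^esub> ?U"
    by (rule cgenideal_minimal[OF idl])
  moreover have "Idl\<^bsub>gauss_ring\<^esub> ?U \<subseteq> gauss_PIdl d"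
    using d(2,3) by (intro genideal_minimal ideal_gauss_PIdl dG Un_least) (simp_all only: gauss_PIdl_subset_iff)
  ultimately show ?thesis unfolding ideal_gcd_def by blast
qed

text \<open>The sum of the ideals \<open>(a)\<close> and \<open>(b)\<close> consists of the
  combinations \<open>r * a + s * b\<close> and is principal. A generator of it is a common divisor
  and comes with Bezout coefficients.\<close>

lemma gauss_gcd_exists:
  assumes "a \<in> gauss_int" "b \<in> gauss_int" "a \<noteq> 0"
  obtains d r s where "d \<in> gauss_int" "d \<noteq> 0" "r \<in> gauss_int" "s \<in> gauss_int"
    "d = r * a + s * b" "a \<in> gauss_PIdl d" "b \<in> gauss_PIdl d"
proof -
  interpret cring gauss_ring by (rule cring_gauss_ring)
  define I where "I = {r * a + s * b | r s. r \<in> gauss_int \<and> s \<in> gauss_int}"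
  have "gauss_PIdl a <+>\<^bsub>gauss_ring\<^esub> gauss_PIdl b = I"
    unfolding I_def set_add_def set_mult_def add_monoid_gauss_ring_mult gauss_PIdl_eq_Collect
  proof (intro equalityI subsetI)
    fix x assume "x \<in> (\<Union>h\<in>{w * a |w. w \<in> gauss_int}. \<Union>k\<in>{w * b |w. w \<in> gauss_int}. {h + k})"
    then show "x \<in> {r * a + s * b |r s. r \<in> gauss_int \<and> s \<in> gauss_int}" by blast
  next
    fix x assume "x \<in> {r * a + s * b |r s. r \<in> gauss_int \<and> s \<in> gauss_int}"
    then obtain r s where "r \<in> gauss_int" "s \<in> gauss_int" "x = r * a + s * b" by blast
    then show "x \<in> (\<Union>h\<in>{w * a |w. w \<in> gauss_int}. \<Union>k\<in>{w * b |w. w \<in> gauss_int}. {h + k})"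
      by (intro UN_I[of "r * a"] UN_I[of "s * b"]) blast+
  qed
  moreover have "ideal (gauss_PIdl a <+>\<^bsub>gauss_ring\<^esub> gauss_PIdl b) gauss_ring"
    by (intro add_ideals ideal_gauss_PIdl assms)
  ultimately have "ideal I gauss_ring" by (simp only:)
  then obtain d where d: "d \<in> gauss_int" "I = gauss_PIdl d"
    by (rule gauss_ideal_principal)
  have "1 * a + 0 * b \<in> I" "0 * a + 1 * b \<in> I"
    unfolding I_def using gauss_int_simps(1,2) by blast+
  then have ab: "a \<in> gauss_PIdl d" "b \<in> gauss_PIdl d" unfolding d(2) by simp_all
  have "d \<in> I" unfolding d(2) by (rule gauss_PIdl_self)
  then obtain r s where rs: "r \<in> gauss_int" "s \<in> gauss_int" "d = r * a + s * b"
    unfolding I_def by blast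
  have "d \<noteq> 0" using ab(1) assms(3) by (auto simp: gauss_PIdl_0)
  then show ?thesis by (rule that[OF d(1) _ rs ab])
qed

lemma ideal_norm_nonzero_ideal:
  assumes "I \<in> nonzero_ideals"
  shows "ideal_norm I \<in> \<nat>" "ideal_norm I \<ge> 1"
proof -
  obtain \<eta> where \<eta>: "\<eta> \<in> gauss_int" "\<eta> \<noteq> 0" "I = gauss_PIdl \<eta>"
    using assms by (rule nonzero_idealsE)
  then show *: "ideal_norm I \<in> \<nat>" by (simp add: ideal_norm_PIdl gauss_norm_Nats)
  have "ideal_norm I \<noteq> 0" using \<eta> by (simp add: ideal_norm_PIdl gauss_norm_cmod)
  with * obtain n where "ideal_norm I = real n" "n \<noteq> 0" by (metis Nats_cases of_nat_0)
  then show "ideal_norm I \<ge> 1" by simp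
qed

section \<open>The involution that exchanges an ideal with a gcd\<close>

definition gauss_gen :: "complex set \<Rightarrow> complex" where
  "gauss_gen I = (SOME \<eta>. \<eta> \<in> gauss_int \<and> gauss_PIdl \<eta> = I)"

lemma gauss_gen:
  assumes "I \<in> nonzero_ideals"
  shows "gauss_gen I \<in> gauss_int" "gauss_PIdl (gauss_gen I) = I" "gauss_gen I \<noteq> 0"
proof -
  obtain \<eta> where \<eta>: "\<eta> \<in> gauss_int" "\<eta> \<noteq> 0" "I = gauss_PIdl \<eta>"
    using assms by (rule nonzero_idealsE)
  then have "\<eta> \<in> gauss_int \<and> gauss_PIdl \<eta> = I" by simp
  then have "gauss_gen I \<in> gauss_int \<and> gauss_PIdl (gauss_gen I) = I"
    unfolding gauss_gen_def by (rule someI)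
  then show "gauss_gen I \<in> gauss_int" and *: "gauss_PIdl (gauss_gen I) = I"
    by blast+
  show "gauss_gen I \<noteq> 0"
  proof
    assume "gauss_gen I = 0"
    with * have "I = {0}" by (simp add: gauss_PIdl_0)
    with assms show False by (simp add: nonzero_ideals_def)
  qed
qed

text \<open>The quotients \<open>E I / D\<close> and \<open>E J / D\<close> of ideals are formed on
  chosen generators, so that division takes place in the complex numbers;
  \<open>gcd_swap_PIdl\<close> shows independence of the choice.\<close>

definition gcd_swap :: "complex set \<times> complex set \<times> complex set \<Rightarrow> complex set \<times> complex set \<times> complex set" where
  "gcd_swap = (\<lambda>(E, I, J). let d = gauss_gen (ideal_gcd I J) in
     (ideal_gcd I J, gauss_PIdl (gauss_gen E * gauss_gen I / d), gauss_PIdl (gauss_gen E * gauss_gen J / d)))"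

text \<open>Other generators change the quotient only by a unit. To avoid handling units, both sides
  are multiplied by the chosen generator of \<open>(d)\<close>, compared as products, and the factor
  is cancelled.\<close>

lemma gcd_swap_PIdl:
  assumes G: "e \<in> gauss_int" "a \<in> gauss_int" "b \<in> gauss_int" "d \<in> gauss_int"
    and nz: "e \<noteq> 0" "d \<noteq> 0" "a \<noteq> 0" "b \<noteq> 0"
    and gcd: "ideal_gcd (gauss_PIdl a) (gauss_PIdl b) = gauss_PIdl d"
  shows "gcd_swap (gauss_PIdl e, gauss_PIdl a, gauss_PIdl b) =
    (gauss_PIdl d, gauss_PIdl (e * a / d), gauss_PIdl (e * b / d))"
proof -
  have *: "gauss_PIdl (gauss_gen (gauss_PIdl e) * gauss_gen (gauss_PIdl c) / gauss_gen (gauss_PIdl d))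
      = gauss_PIdl (e * c / d)" if "c \<in> gauss_int" "c \<noteq> 0" for c
  proof -
    let ?g = "\<lambda>z. gauss_gen (gauss_PIdl z)"
    have g: "gauss_PIdl (?g z) = gauss_PIdl z" "?g z \<noteq> 0" if "z \<in> gauss_int" "z \<noteq> 0" for z
      using gauss_gen(2,3)[OF gauss_PIdl_nonzero_ideals[OF that]] by auto
    have "gauss_PIdl (?g d * (?g e * ?g c / ?g d)) = gauss_PIdl (?g e * ?g c)"
      using g[OF G(4) nz(2)] by simp
    also have "\<dots> = gauss_PIdl (e * c)"
      using that G nz by (intro gauss_PIdl_mult_cong g)
    also have "\<dots> = gauss_PIdl (d * (e * c / d))" using nz by simp
    also have "\<dots> = gauss_PIdl (?g d * (e * c / d))"
      using G nz by (intro gauss_PIdl_mult_cong g[symmetric] refl)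
    finally show ?thesis unfolding gauss_PIdl_mult_cancel[OF g(2)[OF G(4) nz(2)]] .
  qed
  show ?thesis using G nz by (simp add: gcd_swap_def gcd Let_def *)
qed

text \<open>Write \<open>a = a' * d\<close> and \<open>b = b' * d\<close>. Then the new pair is
  generated by \<open>e * a'\<close> and \<open>e * b'\<close>, with \<open>a'\<close> and
  \<open>b'\<close> coprime, so its gcd is \<open>(e)\<close>; a second swap multiplies by
  \<open>d\<close> and divides by \<open>e\<close>, which restores \<open>a\<close> and
  \<open>b\<close>. The norm identities follow from multiplicativity.\<close>

lemma gcd_swap_involution:
  assumes "E \<in> nonzero_ideals" "I \<in> nonzero_ideals" "J \<in> nonzero_ideals"
  obtains I' J' where "gcd_swap (E, I, J) = (ideal_gcd I J, I', J')"
    "gcd_swap (ideal_gcd I J, I', J') = (E, I, J)" "ideal_gcd I' J' = E"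
    "ideal_gcd I J \<in> nonzero_ideals" "I' \<in> nonzero_ideals" "J' \<in> nonzero_ideals"
    "ideal_norm E * ideal_norm I = ideal_norm (ideal_gcd I J) * ideal_norm I'"
    "ideal_norm E * ideal_norm J = ideal_norm (ideal_gcd I J) * ideal_norm J'"
proof -
  obtain e where e: "e \<in> gauss_int" "e \<noteq> 0" "E = gauss_PIdl e"
    using assms by (elim nonzero_idealsE)
  obtain a where a: "a \<in> gauss_int" "a \<noteq> 0" "I = gauss_PIdl a"
    using assms by (elim nonzero_idealsE)
  obtain b where b: "b \<in> gauss_int" "b \<noteq> 0" "J = gauss_PIdl b"
    using assms by (elim nonzero_idealsE)
  obtain d r s where d: "d \<in> gauss_int" "d \<noteq> 0" "r \<in> gauss_int" "s \<in> gauss_int"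
    "d = r * a + s * b" "a \<in> gauss_PIdl d" "b \<in> gauss_PIdl d"
    using a b by (elim gauss_gcd_exists[of a b])
  have D: "ideal_gcd I J = gauss_PIdl d"
    unfolding a(3) b(3) by (rule ideal_gcd_PIdl[OF a(1) b(1) d(3-7)])
  obtain a' b' where a': "a' \<in> gauss_int" "a = a' * d" and b': "b' \<in> gauss_int" "b = b' * d"
    using d(6,7) unfolding gauss_PIdl_iff by blast
  have "d * 1 = d * (r * a' + s * b')"
    using d(5) unfolding a' b' by (simp add: algebra_simps)
  \<comment> \<open>Cancelling \<open>d\<close> turns the Bezout identity for \<open>a\<close> and
    \<open>b\<close> into one for the cofactors, with the same coefficients.\<close>
  then have one: "r * a' + s * b' = 1" using d(2) by (metis mult_cancel_left)
  have gcd': "ideal_gcd (gauss_PIdl (e * a')) (gauss_PIdl (e * b')) = gauss_PIdl e"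
  proof (rule ideal_gcd_PIdl)
    have "e * (r * a' + s * b') = e" unfolding one by simp
    then show "e = r * (e * a') + s * (e * b')" by (simp add: algebra_simps)
    show "e * a' \<in> gauss_PIdl e" "e * b' \<in> gauss_PIdl e"
      unfolding gauss_PIdl_iff using a'(1) b'(1) mult.commute by blast+
  qed (use e(1) a'(1) b'(1) d(3,4) in simp_all)
  have nz: "a' \<noteq> 0" "b' \<noteq> 0" using a(2) b(2) a'(2) b'(2) by auto
  have "gcd_swap (gauss_PIdl e, gauss_PIdl a, gauss_PIdl b)
      = (gauss_PIdl d, gauss_PIdl (e * a / d), gauss_PIdl (e * b / d))"
    by (rule gcd_swap_PIdl[OF e(1) a(1) b(1) d(1) e(2) d(2) a(2) b(2) D[unfolded a(3) b(3)]])
  moreover have "e * a / d = e * a'" "e * b / d = e * b'"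
    unfolding a'(2) b'(2) using d(2) by simp_all
  ultimately have 1: "gcd_swap (E, I, J) = (ideal_gcd I J, gauss_PIdl (e * a'), gauss_PIdl (e * b'))"
    unfolding D unfolding e(3) a(3) b(3) by (simp only:)
  have "gcd_swap (gauss_PIdl d, gauss_PIdl (e * a'), gauss_PIdl (e * b')) =
    (gauss_PIdl e, gauss_PIdl (d * (e * a') / e), gauss_PIdl (d * (e * b') / e))"
    by (rule gcd_swap_PIdl) (use e(1,2) d(1,2) a'(1) b'(1) nz gcd' in simp_all)
  moreover have "d * (e * a') / e = a" "d * (e * b') / e = b"
    unfolding a'(2) b'(2) using e(2) by simp_all
  ultimately have 2: "gcd_swap (ideal_gcd I J, gauss_PIdl (e * a'), gauss_PIdl (e * b')) = (E, I, J)"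
    unfolding D unfolding e(3) a(3) b(3) by (simp only:)
  show ?thesis
  proof (rule that[OF 1 2])
    show "ideal_gcd (gauss_PIdl (e * a')) (gauss_PIdl (e * b')) = E" unfolding e(3) by (rule gcd')
    show "ideal_gcd I J \<in> nonzero_ideals" "gauss_PIdl (e * a') \<in> nonzero_ideals"
        "gauss_PIdl (e * b') \<in> nonzero_ideals"
      unfolding D using d(1,2) e(1,2) a'(1) b'(1) nz by (simp_all add: gauss_PIdl_nonzero_ideals)
    show "ideal_norm E * ideal_norm I = ideal_norm (ideal_gcd I J) * ideal_norm (gauss_PIdl (e * a'))"
      unfolding D unfolding e(3) a(3) using e(1) a(1) d(1) a'(1)
      by (simp add: ideal_norm_PIdl) (simp add: a'(2) gauss_norm_mult)
    show "ideal_norm E * ideal_norm J = ideal_norm (ideal_gcd I J) * ideal_norm (gauss_PIdl (e * b'))"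
      unfolding D unfolding e(3) b(3) using e(1) b(1) d(1) b'(1)
      by (simp add: ideal_norm_PIdl) (simp add: b'(2) gauss_norm_mult)
  qed
qed

section \<open>Units and the number of generators of an ideal\<close>

lemma gauss_units:
  assumes "u \<in> gauss_int" "gauss_norm u = 1"
  shows "u \<in> {1, -1, \<i>, -\<i>}"
proof -
  obtain a b :: int where ab: "Re u = of_int a" "Im u = of_int b"
    using assms by (auto simp: gauss_int_iff elim!: Ints_cases)
  have "of_int (a\<^sup>2 + b\<^sup>2) = (1::real)"
    using assms by (simp add: gauss_norm_def ab)
  then have *: "a\<^sup>2 + b\<^sup>2 = 1" by linarith
  have "a\<^sup>2 \<ge> 0" "b\<^sup>2 \<ge> 0" by auto
  then have "(a\<^sup>2 = 1 \<and> b\<^sup>2 = 0) \<or> (a\<^sup>2 = 0 \<and> b\<^sup>2 = 1)" using * by linarith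
  then show ?thesis
    by (auto simp: complex_eq_iff ab power2_eq_1_iff)
qed

text \<open>Two generators of the same nonzero ideal differ by a factor of norm 1, and the four such
  factors give distinct products. This is the ratio between lattice points and ideals.\<close>

lemma card_gauss_generators:
  assumes "I \<in> nonzero_ideals"
  shows "card {\<eta> \<in> gauss_int. gauss_PIdl \<eta> = I} = 4"
proof -
  obtain \<eta> where \<eta>: "\<eta> \<in> gauss_int" "\<eta> \<noteq> 0" "I = gauss_PIdl \<eta>"
    using assms by (rule nonzero_idealsE)
  have "{\<xi> \<in> gauss_int. gauss_PIdl \<xi> = I} = (\<lambda>u. u * \<eta>) ` {1, -1, \<i>, -\<i>}"
  proof (intro equalityI subsetI)
    fix \<xi> assume "\<xi> \<in> {\<xi> \<in> gauss_int. gauss_PIdl \<xi> = I}"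
    then have \<xi>: "\<xi> \<in> gauss_int" "gauss_PIdl \<xi> = gauss_PIdl \<eta>" using \<eta> by auto
    then obtain u where u: "u \<in> gauss_int" "\<xi> = u * \<eta>"
      by (metis gauss_PIdl_iff gauss_PIdl_self)
    have "gauss_norm \<xi> = gauss_norm \<eta>"
      using \<xi> \<eta> by (metis ideal_norm_PIdl)
    then have "gauss_norm u = 1" using u(2) \<eta>(2) by (simp add: gauss_norm_cmod norm_mult)
    then show "\<xi> \<in> (\<lambda>u. u * \<eta>) ` {1, -1, \<i>, -\<i>}" using gauss_units[OF u(1)] u(2) by blast
  next
    fix \<xi> assume "\<xi> \<in> (\<lambda>u. u * \<eta>) ` {1, -1, \<i>, -\<i>}"
    then obtain u where u: "\<xi> = u * \<eta>" "u \<in> {1, -1, \<i>, -\<i>}" by blast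
    \<comment> \<open>The conjugate of a unit is its inverse, which yields the reverse
      divisibility.\<close>
    then have "cnj u \<in> gauss_int" "cnj u * u = 1" and uG: "u \<in> gauss_int" by auto
    then have "cnj u \<in> gauss_int" "\<eta> = cnj u * \<xi>" by (simp_all add: u(1) flip: mult.assoc)
    then have "gauss_PIdl \<xi> = gauss_PIdl \<eta>"
      using u(1) uG unfolding gauss_PIdl_eq_iff gauss_PIdl_iff by blast
    then show "\<xi> \<in> {\<xi> \<in> gauss_int. gauss_PIdl \<xi> = I}"
      using u(1) uG \<eta>(1) unfolding \<eta>(3) by simp
  qed
  moreover have "inj_on (\<lambda>u. u * \<eta>) {1, -1, \<i>, -\<i>}" using \<eta> by (auto simp: inj_on_def)
  moreover have "card {1, -1, \<i>, -\<i>} = 4" by (auto simp: complex_eq_iff card_insert_if)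
  ultimately show ?thesis by (simp only: card_image)
qed

subsection \<open>Counting ideals\<close>

lemma finite_gauss_disc: "finite {z \<in> gauss_int. cmod z \<le> r}"
proof (rule finite_subset)
  show "{z \<in> gauss_int. cmod z \<le> r}
      \<subseteq> (\<lambda>(a, b). Complex (of_int a) (of_int b)) ` ({- \<lceil>r\<rceil>..\<lceil>r\<rceil>} \<times> {- \<lceil>r\<rceil>..\<lceil>r\<rceil>})"
  proof
    fix z assume z: "z \<in> {z \<in> gauss_int. cmod z \<le> r}"
    then obtain a b :: int where ab: "Re z = of_int a" "Im z = of_int b"
      by (auto simp: gauss_int_iff elim!: Ints_cases)
    have "\<bar>of_int a\<bar> \<le> r" "\<bar>of_int b\<bar> \<le> r"
      using z abs_Re_le_cmod[of z] abs_Im_le_cmod[of z] by (auto simp: ab)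
    then have "a \<in> {- \<lceil>r\<rceil>..\<lceil>r\<rceil>}" "b \<in> {- \<lceil>r\<rceil>..\<lceil>r\<rceil>}"
      by (simp_all add: abs_le_iff) linarith+
    moreover have "z = Complex (of_int a) (of_int b)" by (simp add: complex_eq_iff ab)
    ultimately show "z \<in> (\<lambda>(a, b). Complex (of_int a) (of_int b)) ` ({- \<lceil>r\<rceil>..\<lceil>r\<rceil>} \<times> {- \<lceil>r\<rceil>..\<lceil>r\<rceil>})"
      by force
  qed
qed auto

text \<open>A unit square has circumradius sqrt (1/2); this accounts for the margin of 1 around the
  disc below.\<close>

lemma cmod_less_1_of_half:
  assumes "\<bar>Re z\<bar> \<le> 1/2" "\<bar>Im z\<bar> \<le> 1/2"
  shows "cmod z < 1"
proof -
  have "(Re z)\<^sup>2 \<le> (1/2)\<^sup>2" "(Im z)\<^sup>2 \<le> (1/2)\<^sup>2"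
    using assms by (metis abs_ge_zero power2_abs power_mono)+
  then have "(cmod z)\<^sup>2 < 1\<^sup>2" unfolding cmod_power2 by (simp add: power2_eq_square)
  then show ?thesis by (rule power_less_imp_less_base) simp
qed

text \<open>
  Unit squares centred at the Gaussian integers in a disc of radius \<open>r\<close> are disjoint, lie in the
  disc of radius \<open>r + 1\<close> and cover the disc of radius \<open>r - 1\<close>.
\<close>
lemma card_gauss_disc:
  assumes "r \<ge> 1"
  shows "\<bar>real (card {z \<in> gauss_int. cmod z \<le> r}) - pi * r\<^sup>2\<bar> \<le> 3 * pi * r"
proof -
  let ?S = "{z \<in> gauss_int. cmod z \<le> r}"
  define h where "h = Complex (1/2) (1/2)"
  \<comment> \<open>The open squares \<open>U\<close> are disjoint and bound the count from above;
    the closed squares \<open>V\<close> cover the smaller disc and bound it from below. Both have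
    measure 1.\<close>
  define U where "U = (\<lambda>z. box (z - h) (z + h))"
  define V where "V = (\<lambda>z. cbox (z - h) (z + h))"
  have fin: "finite ?S" by (rule finite_gauss_disc)
  have mU: "measure lborel (U z) = 1" and mV: "measure lborel (V z) = 1" for z
    by (simp_all add: U_def V_def h_def measure_lborel_box_eq measure_lborel_cbox_eq Basis_complex_def)
  have V_iff: "w \<in> V z \<longleftrightarrow> \<bar>Re w - Re z\<bar> \<le> 1/2 \<and> \<bar>Im w - Im z\<bar> \<le> 1/2" for w z
    unfolding abs_diff_le_iff by (auto simp: V_def h_def in_cbox_complex_iff)
  have U_iff: "w \<in> U z \<longleftrightarrow> \<bar>Re w - Re z\<bar> < 1/2 \<and> \<bar>Im w - Im z\<bar> < 1/2" for w z
    unfolding abs_diff_less_iff by (auto simp: U_def h_def in_box_complex_iff)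
  have ball: "measure lborel (ball (0::complex) t) = pi * t\<^sup>2" if "t \<ge> 0" for t
    using that by (simp add: content_ball unit_ball_vol_2)
  have "disjoint_family_on U ?S"
  proof (unfold disjoint_family_on_def, intro ballI impI)
    fix y z assume yz: "y \<in> ?S" "z \<in> ?S" "y \<noteq> z"
    obtain a b c d :: int where *: "Re y = of_int a" "Im y = of_int b" "Re z = of_int c" "Im z = of_int d"
      using yz by (auto simp: gauss_int_iff elim!: Ints_cases)
    have False if "w \<in> U y" "w \<in> U z" for w
    proof -
      have "\<bar>real_of_int (a - c)\<bar> < 1" "\<bar>real_of_int (b - d)\<bar> < 1"
        using that unfolding U_iff * by linarith+
      then have "a = c" "b = d" by linarith+
      then show False using yz(3) by (simp add: complex_eq_iff *)
    qed
    then show "U y \<inter> U z = {}" by blast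
  qed
  then have "real (card ?S) = measure lborel (\<Union>z\<in>?S. U z)"
    using fin by (subst measure_finite_Union) (simp_all add: mU, auto simp: U_def emeasure_lborel_box_eq)
  also have "\<dots> \<le> measure lborel (ball 0 (r + 1) :: complex set)"
  proof (rule measure_mono_fmeasurable)
    show "(\<Union>z\<in>?S. U z) \<subseteq> ball 0 (r + 1)"
    proof (clarify)
      fix w z assume "w \<in> U z" "cmod z \<le> r"
      then have "cmod (w - z) < 1" by (intro cmod_less_1_of_half) (auto simp: U_iff)
      then show "w \<in> ball 0 (r + 1)"
        using norm_triangle_ineq2[of w z] \<open>cmod z \<le> r\<close> by (simp add: dist_norm)
    qed
    show "ball 0 (r + 1) \<in> fmeasurable lborel"
      by (intro fmeasurableI emeasure_bounded_finite) auto
  qed (use fin in \<open>auto simp: U_def\<close>)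
  finally have upper: "real (card ?S) \<le> pi * (r + 1)\<^sup>2" using assms ball by simp
  have "pi * (r - 1)\<^sup>2 = measure lborel (ball 0 (r - 1) :: complex set)" using assms ball by simp
  also have "\<dots> \<le> measure lborel (\<Union>z\<in>?S. V z)"
  proof (rule measure_mono_fmeasurable)
    show "ball 0 (r - 1) \<subseteq> (\<Union>z\<in>?S. V z)"
    proof
      fix w :: complex assume w: "w \<in> ball 0 (r - 1)"
      define z where "z = Complex (of_int (round (Re w))) (of_int (round (Im w)))"
      have "w \<in> V z"
        using of_int_round_abs_le[of "Re w"] of_int_round_abs_le[of "Im w"]
        by (simp add: V_iff z_def abs_minus_commute)
      then have "cmod (w - z) < 1" by (intro cmod_less_1_of_half) (auto simp: V_iff)
      then have "cmod z \<le> r"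
        using norm_triangle_ineq2[of z w] w by (simp add: norm_minus_commute)
      moreover have "z \<in> gauss_int" by (simp add: gauss_int_iff z_def)
      ultimately show "w \<in> (\<Union>z\<in>?S. V z)" using \<open>w \<in> V z\<close> by blast
    qed
    show "(\<Union>z\<in>?S. V z) \<in> fmeasurable lborel"
      using fin by (intro fmeasurable.finite_UN) (auto simp: V_def)
  qed auto
  also have "\<dots> \<le> (\<Sum>z\<in>?S. measure lborel (V z))"
    using fin by (intro measure_UNION_le) (auto simp: V_def)
  also have "\<dots> = real (card ?S)" by (simp add: mV)
  finally have lower: "pi * (r - 1)\<^sup>2 \<le> real (card ?S)" .
  \<comment> \<open>For \<open>r \<ge> 1\<close> the constant term pi of both squares is at most
    \<open>pi * r\<close>, which raises the coefficient of the error from 2 to 3.\<close>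
  have "pi * 1 \<le> pi * r" using assms by (intro mult_left_mono) auto
  then have "pi * (r + 1)\<^sup>2 \<le> pi * r\<^sup>2 + 3 * pi * r" "pi * r\<^sup>2 - 3 * pi * r \<le> pi * (r - 1)\<^sup>2"
    by (simp_all add: power2_eq_square algebra_simps)
  with upper lower show ?thesis by linarith
qed

lemma finite_ideals_upto: "finite (ideals_upto x)"
proof (rule finite_subset)
  show "ideals_upto x \<subseteq> gauss_PIdl ` {z \<in> gauss_int. cmod z \<le> sqrt x}"
  proof
    fix I assume I: "I \<in> ideals_upto x"
    then obtain \<eta> where "\<eta> \<in> gauss_int" "\<eta> \<noteq> 0" "I = gauss_PIdl \<eta>"
      unfolding ideals_upto_def by (blast elim: nonzero_idealsE)
    with I show "I \<in> gauss_PIdl ` {z \<in> gauss_int. cmod z \<le> sqrt x}"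
      by (auto simp: ideals_upto_def ideal_norm_PIdl gauss_norm_cmod real_le_rsqrt)
  qed
qed (simp add: finite_gauss_disc)

text \<open>The nonzero points of the disc split into the sets of generators of the ideals, four
  points in each; the additional 1 counts the origin.\<close>

lemma card_gauss_disc_ideals:
  assumes "x \<ge> 0"
  shows "card {z \<in> gauss_int. cmod z \<le> sqrt x} = 4 * card (ideals_upto x) + 1"
proof -
  let ?F = "\<lambda>I. {\<eta> \<in> gauss_int. gauss_PIdl \<eta> = I}"
  have le_iff: "cmod z \<le> sqrt x \<longleftrightarrow> gauss_norm z \<le> x" for z
    using assms by (metis gauss_norm_cmod norm_ge_zero real_le_lsqrt real_sqrt_le_iff real_sqrt_unique)
  have F: "?F I \<subseteq> {z \<in> gauss_int. cmod z \<le> sqrt x} - {0}" if "I \<in> ideals_upto x" for I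
    using that by (auto simp: ideals_upto_def nonzero_ideals_def ideal_norm_PIdl le_iff gauss_PIdl_0)
  have "{z \<in> gauss_int. cmod z \<le> sqrt x} - {0} = (\<Union>I\<in>ideals_upto x. ?F I)"
  proof (intro equalityI subsetI)
    fix z assume "z \<in> {z \<in> gauss_int. cmod z \<le> sqrt x} - {0}"
    then have "z \<in> gauss_int" "gauss_PIdl z \<in> ideals_upto x"
      by (auto simp: ideals_upto_def ideal_norm_PIdl le_iff gauss_PIdl_nonzero_ideals)
    then show "z \<in> (\<Union>I\<in>ideals_upto x. ?F I)" by blast
  qed (use F in blast)
  moreover have fin: "finite (?F I)" if "I \<in> ideals_upto x" for I
    using finite_subset[OF F[OF that]] finite_gauss_disc by blast
  ultimately have "card ({z \<in> gauss_int. cmod z \<le> sqrt x} - {0}) = (\<Sum>I\<in>ideals_upto x. card (?F I))"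
    by (simp only:) (rule card_UN_disjoint, use finite_ideals_upto fin in auto)
  also have "\<dots> = (\<Sum>I\<in>ideals_upto x. 4)"
    by (intro sum.cong refl card_gauss_generators) (auto simp: ideals_upto_def)
  finally have "card ({z \<in> gauss_int. cmod z \<le> sqrt x} - {0}) = 4 * card (ideals_upto x)" by simp
  moreover have "0 \<in> {z \<in> gauss_int. cmod z \<le> sqrt x}" using assms by simp
  ultimately show ?thesis
    using finite_gauss_disc[of "sqrt x"] by (metis Suc_eq_plus1 card_Suc_Diff1)
qed

text \<open>A quarter of the lattice point count. The error is at most (3 pi sqrt x + 1) / 4, which
  pi < 4 and 1 \<le> sqrt x bring below 4 sqrt x.\<close>

lemma card_ideals_upto:
  assumes "x \<ge> 1"
  shows "\<bar>real (card (ideals_upto x)) - pi / 4 * x\<bar> \<le> 4 * sqrt x"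
proof -
  have "\<bar>real (card {z \<in> gauss_int. cmod z \<le> sqrt x}) - pi * (sqrt x)\<^sup>2\<bar> \<le> 3 * pi * sqrt x"
    using assms by (intro card_gauss_disc) simp
  moreover have "(sqrt x)\<^sup>2 = x" using assms by simp
  moreover have "pi * sqrt x \<le> 4 * sqrt x" using pi_less_4 assms by (intro mult_right_mono) auto
  moreover have "sqrt x \<ge> 1" using assms by simp
  moreover have "real (card {z \<in> gauss_int. cmod z \<le> sqrt x}) = 4 * real (card (ideals_upto x)) + 1"
    using assms by (simp add: card_gauss_disc_ideals)
  ultimately show ?thesis
    by (simp only: abs_le_iff mult.assoc) linarith
qed

subsection \<open>Sums over ideals\<close>

lemma ideal_norm_pos: "I \<in> ideals_upto x \<Longrightarrow> ideal_norm I > 0"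
  using ideal_norm_nonzero_ideal(2)[of I] by (simp add: ideals_upto_def)

lemma ideals_upto_less_1: "x < 1 \<Longrightarrow> ideals_upto x = {}"
  using ideal_norm_nonzero_ideal(2) by (force simp: ideals_upto_def)

text \<open>A cruder bound that also holds below 1, where there are no ideals. The constant is 1
  (from pi/4 \<le> 1) plus the 4 of the error term, as sqrt x \<le> x.\<close>

lemma card_ideals_upto_le:
  assumes "x \<ge> 0"
  shows "real (card (ideals_upto x)) \<le> 5 * x"
proof (cases "x \<ge> 1")
  case True
  have "sqrt x \<le> x"
    using True real_sqrt_le_mono[of x "x * x"] by (simp add: mult_le_cancel_left)
  moreover have "pi / 4 * x \<le> 1 * x"
    using pi_less_4 True by (intro mult_right_mono) auto
  ultimately show ?thesis using card_ideals_upto[OF True] by linarith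
qed (use assms in \<open>simp add: ideals_upto_less_1\<close>)

text \<open>Norms are naturals, so sums with a real cutoff reduce to natural cutoffs, for which
  partial summation is available.\<close>

lemma ideals_upto_floor:
  assumes "x \<ge> 0"
  shows "ideals_upto x = ideals_upto (real (nat \<lfloor>x\<rfloor>))"
proof -
  have "ideal_norm I \<le> x \<longleftrightarrow> ideal_norm I \<le> real (nat \<lfloor>x\<rfloor>)" if "I \<in> nonzero_ideals" for I
  proof -
    obtain m where m: "ideal_norm I = real m"
      using ideal_norm_nonzero_ideal(1) \<open>I \<in> nonzero_ideals\<close> by (metis Nats_cases)
    have "real m \<le> x \<longleftrightarrow> int m \<le> \<lfloor>x\<rfloor>" by (simp add: le_floor_iff)
    also have "\<dots> \<longleftrightarrow> m \<le> nat \<lfloor>x\<rfloor>" using assms by (simp only: le_nat_iff zero_le_floor)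
    finally show ?thesis unfolding m of_nat_le_iff .
  qed
  then show ?thesis by (auto simp: ideals_upto_def)
qed

text \<open>Partial summation by induction: each step adds the ideals \<open>?P\<close> of norm
  exactly \<open>Suc n\<close>. The term for \<open>k = 0\<close> vanishes because the count at 0 is
  0, which makes a pole of \<open>f\<close> at 0 harmless.\<close>

lemma sum_ideals_upto_Abel:
  fixes f :: "real \<Rightarrow> real"
  shows "(\<Sum>I\<in>ideals_upto (real n). f (ideal_norm I)) =
    real (card (ideals_upto (real n))) * f (real n)
      + (\<Sum>k<n. real (card (ideals_upto (real k))) * (f (real k) - f (real (Suc k))))"
proof (induction n)
  case 0
  show ?case by (simp add: ideals_upto_less_1)
next
  case (Suc n)
  let ?P = "{I \<in> nonzero_ideals. ideal_norm I = real (Suc n)}"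
  have "ideal_norm I \<le> real (Suc n) \<longleftrightarrow> ideal_norm I \<le> real n \<or> ideal_norm I = real (Suc n)"
    if "I \<in> nonzero_ideals" for I
  proof -
    obtain m where "ideal_norm I = real m" 
      using ideal_norm_nonzero_ideal(1) \<open>I \<in> nonzero_ideals\<close> by (metis Nats_cases)
    then show ?thesis by (simp only: of_nat_le_iff of_nat_eq_iff) linarith
  qed
  then have U: "ideals_upto (real (Suc n)) = ideals_upto (real n) \<union> ?P"
    by (auto simp: ideals_upto_def simp del: of_nat_Suc)
  have disj: "ideals_upto (real n) \<inter> ?P = {}" by (auto simp: ideals_upto_def)
  have fin: "finite ?P" using finite_ideals_upto[of "real (Suc n)"] unfolding U by simp
  have "(\<Sum>I\<in>ideals_upto (real (Suc n)). f (ideal_norm I)) =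
      (\<Sum>I\<in>ideals_upto (real n). f (ideal_norm I)) + real (card ?P) * f (real (Suc n))"
    unfolding U by (subst sum.union_disjoint[OF finite_ideals_upto fin disj]) simp
  moreover have "card (ideals_upto (real (Suc n))) = card (ideals_upto (real n)) + card ?P"
    unfolding U by (rule card_Un_disjoint[OF finite_ideals_upto fin disj])
  ultimately show ?case
    by (simp only: Suc.IH of_nat_add sum.lessThan_Suc) (simp add: algebra_simps)
qed

text \<open>In terms of \<open>s\<close> and \<open>t\<close>, the differences arising from partial
  summation become rational expressions, and the last equation makes them telescope.\<close>

lemma sqrt_Suc_facts:
  fixes k :: nat
  assumes "k > 0"
  defines "s \<equiv> sqrt (real k)" and "t \<equiv> sqrt (real (Suc k))"
  shows "s > 0" "t > 0" "s \<le> t" "s * s = real k" "t * t = real (Suc k)" "(t - s) * (t + s) = 1"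
proof -
  show "s > 0" "t > 0" "s \<le> t" and *: "s * s = real k" "t * t = real (Suc k)"
    using assms(1) by (auto simp: s_def t_def)
  then show "(t - s) * (t + s) = 1" by (simp add: algebra_simps)
qed

text \<open>Partial summation with the count written as pi/4 k + \<open>e k\<close>: the main part
  produces a harmonic number, and the errors contribute a convergent series with terms of order
  k^(-3/2).\<close>

lemma sum_inverse_norm_bound:
  assumes "n > 0"
  shows "\<bar>(\<Sum>I\<in>ideals_upto (real n). 1 / ideal_norm I) - pi / 4 * ln (real n)\<bar> \<le> 30"
proof -
  define e where "e = (\<lambda>k. real (card (ideals_upto (real k))) - pi / 4 * real k)"
  have e: "\<bar>e k\<bar> \<le> 4 * sqrt (real k)" for k
    using card_ideals_upto[of "real k"] by (cases "k = 0") (auto simp: e_def ideals_upto_less_1)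
  \<comment> \<open>For \<open>k > 0\<close> the summand is pi/4 times 1/(k + 1), and for
    \<open>k = 0\<close> it is 0; what results is the harmonic number without its first
    term.\<close>
  have main: "(\<Sum>k<m. pi / 4 * real k * (1 / real k - 1 / real (Suc k))) = pi / 4 * (harm m - 1)"
    if "m > 0" for m :: nat
    using that
  proof (induction m rule: nat_induct_non_zero)
    case (Suc m)
    have "a * (1 / a - 1 / b) = (b - a) / b" if "a \<noteq> 0" "b \<noteq> 0" for a b :: real
      using that by (simp add: field_simps)
    from this[of "real m" "real (Suc m)"]
    have "real m * (1 / real m - 1 / real (Suc m)) = 1 / real (Suc m)"
      using Suc.hyps by simp
    then have step: "pi / 4 * real m * (1 / real m - 1 / real (Suc m)) = pi / 4 * (1 / real (Suc m))"
      by (simp only: mult.assoc)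
    show ?case
      unfolding sum.lessThan_Suc Suc.IH harm_Suc step inverse_eq_divide
      by (simp add: ring_distribs del: of_nat_Suc)
  qed (simp add: harm_Suc harm_def)
  \<comment> \<open>The subtracted 2 / sqrt m makes the induction work: the increment is at most 2 /
    sqrt m - 2 / sqrt (m + 1).\<close>
  have err: "(\<Sum>k<m. sqrt (real k) * (1 / real k - 1 / real (Suc k))) \<le> 3 - 2 / sqrt (real m)"
    if "m > 0" for m :: nat
    using that
  proof (induction m rule: nat_induct_non_zero)
    case (Suc m)
    define s t where "s = sqrt (real m)" and "t = sqrt (real (Suc m))"
    note st = sqrt_Suc_facts[OF Suc.hyps, folded s_def t_def]
    have "s * (1 / (s * s) - 1 / (t * t)) = (t - s) * (t + s) / (s * t * t)"
      using st(1,2) by (simp add: field_simps)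
    also have "\<dots> \<le> (t - s) * (2 * t) / (s * t * t)"
      using st(1-3) by (intro divide_right_mono mult_left_mono) auto
    also have "\<dots> = 2 / s - 2 / t"
      using st(1,2) by (simp add: field_simps)
    finally have "sqrt (real m) * (1 / real m - 1 / real (Suc m)) \<le> 2 / sqrt (real m) - 2 / sqrt (real (Suc m))"
      unfolding st(4,5) unfolding s_def t_def .
    with Suc.IH show ?case unfolding sum.lessThan_Suc by linarith
  qed simp
  have "\<bar>\<Sum>k<n. e k * (1 / real k - 1 / real (Suc k))\<bar>
      \<le> (\<Sum>k<n. 4 * (sqrt (real k) * (1 / real k - 1 / real (Suc k))))"
  proof (rule order_trans[OF sum_abs sum_mono])
    fix k
    show "\<bar>e k * (1 / real k - 1 / real (Suc k))\<bar> \<le> 4 * (sqrt (real k) * (1 / real k - 1 / real (Suc k)))"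
    proof (cases "k = 0")
      case False
      then have "1 / real k - 1 / real (Suc k) \<ge> 0" by (simp add: field_simps)
      then show ?thesis
        using mult_right_mono[OF e[of k]] by (simp add: abs_mult mult.assoc)
    qed (simp add: e_def ideals_upto_less_1)
  qed
  also have "\<dots> \<le> 12" 
    using err[OF assms] unfolding sum_distrib_left[symmetric]
    by (smt (verit) divide_nonneg_nonneg real_sqrt_ge_zero of_nat_0_le_iff)
  finally have E: "\<bar>\<Sum>k<n. e k * (1 / real k - 1 / real (Suc k))\<bar> \<le> 12" .
  have "(\<Sum>I\<in>ideals_upto (real n). 1 / ideal_norm I) =
    real (card (ideals_upto (real n))) * (1 / real n)
      + (\<Sum>k<n. real (card (ideals_upto (real k))) * (1 / real k - 1 / real (Suc k)))"
    by (rule sum_ideals_upto_Abel)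
  also have "(\<Sum>k<n. real (card (ideals_upto (real k))) * (1 / real k - 1 / real (Suc k)))
     = (\<Sum>k<n. pi / 4 * real k * (1 / real k - 1 / real (Suc k)))
      + (\<Sum>k<n. e k * (1 / real k - 1 / real (Suc k)))"
    unfolding sum.distrib[symmetric] distrib_right[symmetric] by (simp add: e_def)
  finally have eq: "(\<Sum>I\<in>ideals_upto (real n). 1 / ideal_norm I) =
      real (card (ideals_upto (real n))) * (1 / real n) + pi / 4 * (harm n - 1)
      + (\<Sum>k<n. e k * (1 / real k - 1 / real (Suc k)))"
    unfolding main[OF assms] by simp
  have A: "0 \<le> real (card (ideals_upto (real n))) * (1 / real n)"
    "real (card (ideals_upto (real n))) * (1 / real n) \<le> 5"
    using card_ideals_upto_le[of "real n"] assms by (simp_all add: field_simps)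
  \<comment> \<open>The difference \<open>harm n - ln n\<close> is nonnegative and decreasing, hence
    at most its value 1 at \<open>n = 1\<close>.\<close>
  have "ln (real n) \<le> ln (real n + 1)" using assms by simp
  then have "0 \<le> harm n - ln (real n)" using ln_le_harm[of n] by linarith
  moreover have "harm n - ln (real n) \<le> 1"
    using euler_mascheroni_sequence_decreasing[of 1 n] assms by (simp add: harm_Suc harm_def)
  ultimately have "\<bar>pi / 4 * (harm n - 1 - ln (real n))\<bar> \<le> 1 * 1"
    unfolding abs_mult using pi_less_4 by (intro mult_mono) auto
  then have "\<bar>pi / 4 * (harm n - 1) - pi / 4 * ln (real n)\<bar> \<le> 1"
    by (simp only: right_diff_distrib)
  then show ?thesis unfolding eq using A E by linarith
qed

text \<open>The crude count 5 k suffices: after partial summation each term is at most 5 (sqrt (k +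
  1) - sqrt k), which telescopes, and the boundary term gives another 5 sqrt n.\<close>

lemma sum_inverse_sqrt_norm_bound:
  "(\<Sum>I\<in>ideals_upto (real n). 1 / sqrt (ideal_norm I)) \<le> 10 * sqrt (real n)"
proof -
  let ?A = "\<lambda>k::nat. real (card (ideals_upto (real k)))"
  have A: "?A k \<le> 5 * real k" for k by (rule card_ideals_upto_le) simp
  have "(\<Sum>k<n. ?A k * (1 / sqrt (real k) - 1 / sqrt (real (Suc k))))
      \<le> (\<Sum>k<n. 5 * sqrt (real (Suc k)) - 5 * sqrt (real k))"
  proof (rule sum_mono)
    fix k
    show "?A k * (1 / sqrt (real k) - 1 / sqrt (real (Suc k))) \<le> 5 * sqrt (real (Suc k)) - 5 * sqrt (real k)"
    proof (cases "k > 0")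
      case True
      define s t where "s = sqrt (real k)" and "t = sqrt (real (Suc k))"
      note st = sqrt_Suc_facts[OF True, folded s_def t_def]
      have "?A k * (1 / s - 1 / t) \<le> 5 * real k * (1 / s - 1 / t)"
        using st(1-3) by (intro mult_right_mono A) (simp add: field_simps)
      also have "\<dots> = 5 * (s * s) * (1 / s - 1 / t)" by (simp only: st(4))
      also have "\<dots> = 5 * (t - s) * (s / t)" using st(1,2) by (simp add: field_simps)
      also have "\<dots> \<le> 5 * (t - s) * 1" using st(1-3) by (intro mult_left_mono) auto
      finally show ?thesis unfolding s_def t_def by simp
    qed (simp add: ideals_upto_less_1)
  qed
  also have "\<dots> = 5 * sqrt (real n)"
    using sum_lessThan_telescope[of "\<lambda>k. 5 * sqrt (real k)" n] by simp
  finally have "(\<Sum>k<n. ?A k * (1 / sqrt (real k) - 1 / sqrt (real (Suc k)))) \<le> 5 * sqrt (real n)" .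
  moreover have "?A n * (1 / sqrt (real n)) \<le> 5 * real n * (1 / sqrt (real n))"
    by (intro mult_right_mono A) simp
  moreover have "real n / sqrt (real n) = sqrt (real n)" by (rule real_div_sqrt) simp
  then have "5 * real n * (1 / sqrt (real n)) = 5 * sqrt (real n)"
    by (metis mult.assoc mult.right_neutral times_divide_eq_right)
  ultimately show ?thesis
    unfolding sum_ideals_upto_Abel[of "\<lambda>r. 1 / sqrt r"] by linarith
qed

text \<open>Boundedness of the series with exponent 3/2, which later dominates the one with terms ln
  N / N^2. The terms telescope against 15 / sqrt k, and the boundary term adds at most 5.\<close>

lemma sum_inverse_norm_sqrt_bound:
  "(\<Sum>I\<in>ideals_upto (real n). 1 / (ideal_norm I * sqrt (ideal_norm I))) \<le> 20"
proof (cases "n > 0")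
  case n: True
  let ?A = "\<lambda>k::nat. real (card (ideals_upto (real k)))"
  let ?f = "\<lambda>r. 1 / (r * sqrt r)"
  \<comment> \<open>Without the case distinction, 15 / sqrt 0 would be 0 by convention. The value 15
    makes the first difference 0, as is the summand for \<open>k = 0\<close>.\<close>
  let ?g = "\<lambda>k. if k = 0 then 15 else 15 / sqrt (real k)"
  have A: "?A k \<le> 5 * real k" for k by (rule card_ideals_upto_le) simp
  have "(\<Sum>k<n. ?A k * (?f (real k) - ?f (real (Suc k)))) \<le> (\<Sum>k<n. ?g k - ?g (Suc k))"
  proof (rule sum_mono)
    fix k
    show "?A k * (?f (real k) - ?f (real (Suc k))) \<le> ?g k - ?g (Suc k)"
    proof (cases "k > 0")
      case True
      define s t where "s = sqrt (real k)" and "t = sqrt (real (Suc k))"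
      note st = sqrt_Suc_facts[OF True, folded s_def t_def]
      have "s * s * s \<le> t * t * t" using st(1-3) by (intro mult_mono) auto
      then have nn: "1 / (s * s * s) - 1 / (t * t * t) \<ge> 0" using st(1,2) by (simp add: field_simps)
      have "t * t + t * s + s * s \<le> 3 * (t * t)"
      proof -
        have "t * s \<le> t * t" "s * s \<le> t * t"
          using st(1-3) by (auto intro!: mult_left_mono mult_mono)
        then show ?thesis by linarith
      qed
      have "?A k * (1 / (s * s * s) - 1 / (t * t * t)) \<le> 5 * real k * (1 / (s * s * s) - 1 / (t * t * t))"
        using nn by (intro mult_right_mono A)
      also have "\<dots> = 5 * (s * s) * (1 / (s * s * s) - 1 / (t * t * t))" by (simp only: st(4))
      also have "\<dots> = 5 * (t - s) * (t * t + t * s + s * s) / (s * t * t * t)"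
        using st(1,2) by (simp add: field_simps)
      also have "\<dots> \<le> 5 * (t - s) * (3 * (t * t)) / (s * t * t * t)"
        using st(1-3) \<open>t * t + t * s + s * s \<le> 3 * (t * t)\<close> by (intro divide_right_mono mult_left_mono) auto
      also have "\<dots> = 15 / s - 15 / t" using st(1,2) by (simp add: field_simps)
      finally show ?thesis using True unfolding st(4,5) s_def t_def by simp
    qed (simp add: ideals_upto_less_1)
  qed
  also have "\<dots> = ?g 0 - ?g n" by (rule sum_lessThan_telescope')
  also have "\<dots> \<le> 15" using n by simp
  finally have "(\<Sum>k<n. ?A k * (?f (real k) - ?f (real (Suc k)))) \<le> 15" .
  moreover have "?A n * ?f (real n) \<le> 5 * real n * ?f (real n)"
    by (intro mult_right_mono A) simp
  moreover have "5 * real n * ?f (real n) = 5 / sqrt (real n)" using n by simp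
  moreover have "5 / sqrt (real n) \<le> 5 / 1" using n by (intro frac_le) auto
  ultimately show ?thesis
    unfolding sum_ideals_upto_Abel[of ?f] by linarith
qed (simp add: ideals_upto_less_1)

section \<open>A bound below 2 for the zeta series at 2\<close>

lemma first_quadrant_generator:
  assumes "I \<in> nonzero_ideals"
  obtains a b :: nat where "a > 0" "I = gauss_PIdl (Complex (real a) (real b))"
proof -
  note goal = that
  obtain \<eta> where \<eta>: "\<eta> \<in> gauss_int" "\<eta> \<noteq> 0" "I = gauss_PIdl \<eta>"
    using assms by (rule nonzero_idealsE)
  obtain p q :: int where pq: "Re \<eta> = of_int p" "Im \<eta> = of_int q"
    using \<eta>(1) by (auto simp: gauss_int_iff elim!: Ints_cases)
  have unit: "gauss_PIdl (u * \<eta>) = I" if "u \<in> gauss_int" "v \<in> gauss_int" "v * u = 1" for u v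
  proof -
    have "\<eta> = v * (u * \<eta>)" using that(3) by (simp flip: mult.assoc)
    then show ?thesis unfolding \<eta>(3) gauss_PIdl_eq_iff gauss_PIdl_iff using that(1,2) by blast
  qed
  have quadrant: thesis if "u \<in> gauss_int" "v \<in> gauss_int" "v * u = 1"
      "u * \<eta> = Complex (of_int a) (of_int b)" "a > 0" "b \<ge> 0" for u v a b
  proof (rule goal)
    show "nat a > 0" using that(5) by simp
    have "gauss_PIdl (Complex (of_int a) (of_int b)) = I"
      using unit[OF that(1-3)] unfolding that(4) .
    then show "I = gauss_PIdl (Complex (real (nat a)) (real (nat b)))" using that(5,6) by simp
  qed
  have "p \<noteq> 0 \<or> q \<noteq> 0" using \<eta>(2) pq by (auto simp: complex_eq_iff)
  \<comment> \<open>These are the four quarter-turn images of the region \<open>a > 0\<close>,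
    \<open>b \<ge> 0\<close>; each unit below rotates one of them back.\<close>
  then consider "p > 0" "q \<ge> 0" | "q > 0" "- p \<ge> 0" | "- p > 0" "- q \<ge> 0" | "- q > 0" "p \<ge> 0"
    by linarith
  then show thesis
  proof cases
    case 1 then show ?thesis by (intro quadrant[of 1 1 p q]) (auto simp: complex_eq_iff pq)
  next
    case 2 then show ?thesis by (intro quadrant[of "-\<i>" "\<i>" q "-p"]) (auto simp: complex_eq_iff pq)
  next
    case 3 then show ?thesis by (intro quadrant[of "-1" "-1" "-p" "-q"]) (auto simp: complex_eq_iff pq)
  next
    case 4 then show ?thesis by (intro quadrant[of "\<i>" "-\<i>" "-q" p]) (auto simp: complex_eq_iff pq)
  qed
qed

text \<open>Compares 1/k^2 with 1/((k - 1/2)(k + 1/2)), which telescopes; 5/3 is chosen for equality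
  at \<open>n = 1\<close>.\<close>

lemma sum_inverse_squares_le:
  assumes "n > 0"
  shows "(\<Sum>k=1..n. 1 / (real k)\<^sup>2) \<le> 5/3 - 1 / (real n + 1/2)"
  using assms
proof (induction n rule: nat_induct_non_zero)
  case (Suc n)
  have "(real n + 1/2) * (real (Suc n) + 1/2) \<le> (real (Suc n))\<^sup>2"
    by (simp add: power2_eq_square algebra_simps)
  then have "1 / (real (Suc n))\<^sup>2 \<le> 1 / ((real n + 1/2) * (real (Suc n) + 1/2))"
    by (intro frac_le mult_pos_pos) simp_all
  also have "\<dots> = 1 / (real n + 1/2) - 1 / (real (Suc n) + 1/2)"
    by (simp add: field_simps)
  finally show ?case using Suc.IH by simp
qed simp

text \<open>The contraction argument needs a total below 2. With generators in the first quadrant,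
  the axis contributes at most 7/6 and the points off the axis at most 25/36.\<close>

lemma sum_inverse_norm_square_bound:
  assumes "finite F" "F \<subseteq> nonzero_ideals"
  shows "(\<Sum>I\<in>F. 1 / (ideal_norm I)\<^sup>2) \<le> 67/36"
proof -
  have "\<exists>p. fst p > 0 \<and> I = gauss_PIdl (Complex (real (fst p)) (real (snd p)))" if "I \<in> F" for I
    using that assms(2) first_quadrant_generator[of I] by (metis fst_conv snd_conv subsetD)
  then obtain p where p: "\<And>I. I \<in> F \<Longrightarrow> fst (p I) > 0"
    "\<And>I. I \<in> F \<Longrightarrow> I = gauss_PIdl (Complex (real (fst (p I))) (real (snd (p I))))"
    by metis
  have norm: "ideal_norm I = (real (fst (p I)))\<^sup>2 + (real (snd (p I)))\<^sup>2" if "I \<in> F" for I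
    by (subst p(2)[OF that], subst ideal_norm_PIdl) (auto simp: gauss_int_iff gauss_norm_def)
  have inj: "inj_on p F" by (metis inj_onI p(2))
  \<comment> \<open>\<open>insert 0\<close> keeps \<open>Max\<close> meaningful for empty
    \<open>F\<close>, and \<open>Suc\<close> makes \<open>n\<close> positive.\<close>
  define n where "n = Suc (Max (insert 0 ((\<lambda>I. fst (p I) + snd (p I)) ` F)))"
  have le_n: "fst (p I) + snd (p I) \<le> n" if "I \<in> F" for I
    unfolding n_def using assms(1) that by (intro le_SucI Max_ge) auto
  have sub: "p ` F \<subseteq> {1..n} \<times> {0..n}"
  proof (intro image_subsetI)
    fix I assume "I \<in> F"
    then show "p I \<in> {1..n} \<times> {0..n}"
      using p(1)[of I] le_n[of I] by (simp add: mem_Times_iff)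
  qed
  have n: "n > 0" by (simp add: n_def)
  let ?h = "\<lambda>a b. 1 / ((real a)\<^sup>2 + (real b)\<^sup>2)\<^sup>2"
  let ?Q = "\<Sum>k=1..n. 1 / (real k)\<^sup>2"
  have "?Q \<le> 5/3 - 1 / (real n + 1/2)" by (rule sum_inverse_squares_le[OF n])
  moreover have "1 / (real n + 1/2) \<ge> 0" by simp
  ultimately have Q: "?Q \<le> 5/3" by linarith
  have Q0: "?Q \<ge> 0" by (intro sum_nonneg) auto
  \<comment> \<open>For a \<ge> 2 the term 1/a^4 is at most a quarter of 1/a^2; for a = 1 the
    missing 3/4 is added separately.\<close>
  have axis: "(\<Sum>a=1..n. ?h a 0) \<le> 1 + 1/4 * (2/3)"
  proof -
    have "(\<Sum>a=1..n. ?h a 0) \<le> (\<Sum>a=1..n. (if a = 1 then 3/4 else 0) + 1/4 * (1 / (real a)\<^sup>2))"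
    proof (rule sum_mono)
      fix a assume a: "a \<in> {1..n}"
      show "?h a 0 \<le> (if a = 1 then 3/4 else 0) + 1/4 * (1 / (real a)\<^sup>2)"
      proof (cases "a = 1")
        case False
        with a have "2\<^sup>2 \<le> (real a)\<^sup>2" by (intro power_mono) auto
        then have "1 / ((real a)\<^sup>2 * (real a)\<^sup>2) \<le> 1 / (4 * (real a)\<^sup>2)"
          using a by (intro divide_left_mono mult_right_mono) auto
        with False show ?thesis by (simp add: power2_eq_square)
      qed simp
    qed
    also have "\<dots> = 3/4 + 1/4 * ?Q"
      using n by (simp add: sum.distrib sum_distrib_left sum.delta)
    finally show ?thesis using Q by linarith
  qed
  have "(\<Sum>a=1..n. \<Sum>b=1..n. ?h a b) \<le> (\<Sum>a=1..n. \<Sum>b=1..n. 1/4 * ((1 / (real a)\<^sup>2) * (1 / (real b)\<^sup>2)))"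
  proof (intro sum_mono)
    fix a b assume ab: "a \<in> {1..n}" "b \<in> {1..n}"
    let ?x = "(real a)\<^sup>2" and ?y = "(real b)\<^sup>2"
    have pos: "?x > 0" "?y > 0" using ab by auto
    \<comment> \<open>The inequality of arithmetic and geometric means separates the variables, so
      that the double sum becomes a product.\<close>
    have "(?x - ?y)\<^sup>2 \<ge> 0" by simp
    then have "4 * (?x * ?y) \<le> (?x + ?y)\<^sup>2" unfolding power2_eq_square[of "?x - ?y"] power2_eq_square[of "?x + ?y"]
      by (simp add: algebra_simps)
    then have "1 / (?x + ?y)\<^sup>2 \<le> 1 / (4 * (?x * ?y))"
      using pos by (intro divide_left_mono) (auto intro!: mult_pos_pos)
    then show "?h a b \<le> 1/4 * ((1 / ?x) * (1 / ?y))" by simp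
  qed
  also have "\<dots> = 1/4 * (?Q * ?Q)"
    unfolding sum_product unfolding sum_distrib_left ..
  also have "\<dots> \<le> 1/4 * (5/3 * (5/3))"
    using Q Q0 by (intro mult_left_mono mult_mono) auto
  finally have off: "(\<Sum>a=1..n. \<Sum>b=1..n. ?h a b) \<le> 25/36" by simp
  have "(\<Sum>I\<in>F. 1 / (ideal_norm I)\<^sup>2) = (\<Sum>I\<in>F. (\<lambda>(a, b). ?h a b) (p I))"
    by (intro sum.cong refl) (simp add: norm case_prod_beta)
  also have "\<dots> = (\<Sum>q\<in>p ` F. (\<lambda>(a, b). ?h a b) q)"
    by (simp add: sum.reindex[OF inj])
  also have "\<dots> \<le> (\<Sum>q\<in>{1..n} \<times> {0..n}. (\<lambda>(a, b). ?h a b) q)"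
    by (intro sum_mono2 sub) auto
  also have "\<dots> = (\<Sum>a=1..n. \<Sum>b=0..n. ?h a b)"
    by (simp add: sum.cartesian_product)
  also have "\<dots> = (\<Sum>a=1..n. ?h a 0 + (\<Sum>b=1..n. ?h a b))"
    by (intro sum.cong refl, subst sum.atLeast_Suc_atMost) auto
  also have "\<dots> = (\<Sum>a=1..n. ?h a 0) + (\<Sum>a=1..n. \<Sum>b=1..n. ?h a b)"
    by (rule sum.distrib)
  finally show ?thesis using axis off by linarith
qed

subsection \<open>The sum of the norms of the gcds\<close>

lemma ideals_upto_cofinal:
  assumes "finite F" "F \<subseteq> nonzero_ideals"
  obtains n :: nat where "F \<subseteq> ideals_upto (real n)"
proof
  show "F \<subseteq> ideals_upto (real (nat \<lceil>\<Sum>I\<in>F. ideal_norm I\<rceil>))"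
  proof
    fix I assume I: "I \<in> F"
    have "ideal_norm I \<le> (\<Sum>I\<in>F. ideal_norm I)"
    proof (intro member_le_sum I assms(1))
      fix J assume "J \<in> F - {I}"
      then have "ideal_norm J \<ge> 1" using assms(2) by (intro ideal_norm_nonzero_ideal(2)) auto
      then show "0 \<le> ideal_norm J" by simp
    qed
    also have "\<dots> \<le> real (nat \<lceil>\<Sum>I\<in>F. ideal_norm I\<rceil>)" by (rule real_nat_ceiling_ge)
    finally show "I \<in> ideals_upto (real (nat \<lceil>\<Sum>I\<in>F. ideal_norm I\<rceil>))"
      using I assms(2) by (auto simp: ideals_upto_def)
  qed
qed

lemma sum_inverse_norm_sqrt_bound_finite:
  assumes "finite F" "F \<subseteq> nonzero_ideals"
  shows "(\<Sum>I\<in>F. 1 / (ideal_norm I * sqrt (ideal_norm I))) \<le> 20"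
proof -
  obtain n :: nat where n: "F \<subseteq> ideals_upto (real n)" using assms by (rule ideals_upto_cofinal)
  have "(\<Sum>I\<in>F. 1 / (ideal_norm I * sqrt (ideal_norm I)))
      \<le> (\<Sum>I\<in>ideals_upto (real n). 1 / (ideal_norm I * sqrt (ideal_norm I)))"
  proof (intro sum_mono2 finite_ideals_upto n)
    fix I assume "I \<in> ideals_upto (real n) - F"
    then have "ideal_norm I > 0" by (intro ideal_norm_pos[of I "real n"]) simp
    then show "0 \<le> 1 / (ideal_norm I * sqrt (ideal_norm I))" by simp
  qed
  then show ?thesis using sum_inverse_norm_sqrt_bound[of n] by linarith
qed

text \<open>The estimate ln r = 2 ln (sqrt r) \<le> 2 sqrt r reduces the logarithmic series to the
  one with exponent 3/2.\<close>

lemma ln_div_square_le: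
  fixes r :: real
  assumes "r > 0"
  shows "ln r / r\<^sup>2 \<le> 2 * (1 / (r * sqrt r))"
proof -
  have "ln (sqrt r) \<le> sqrt r" using assms ln_le_minus_one[of "sqrt r"] by simp
  then have "ln r \<le> 2 * sqrt r" using assms by (simp add: ln_sqrt)
  then have "ln r / r\<^sup>2 \<le> 2 * sqrt r / r\<^sup>2" by (intro divide_right_mono) auto
  also have "\<dots> = 2 * sqrt r / (r * (sqrt r * sqrt r))" using assms by (simp add: power2_eq_square)
  also have "\<dots> = 2 * (1 / (r * sqrt r))"
  proof -
    have "2 * s / (r * (s * s)) = 2 * (1 / (r * s))" if "s \<noteq> 0" for s
      using that by simp
    from this[of "sqrt r"] show ?thesis using assms by simp
  qed
  finally show ?thesis .
qed

text \<open>A real version of \<open>zeta_Qi 2\<close> on which inequalities can be stated;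
  \<open>zeta_Qi_2\<close> connects the two.\<close>

definition zeta2 :: real where
  "zeta2 = (\<Sum>\<^sub>\<infinity>I\<in>nonzero_ideals. 1 / (ideal_norm I)\<^sup>2)"

lemma summable_zeta2: "(\<lambda>I. 1 / (ideal_norm I)\<^sup>2) summable_on nonzero_ideals"
  using sum_inverse_norm_square_bound
  by (intro nonneg_bdd_above_summable_on bdd_aboveI2[of _ _ "67/36"]) auto

lemma zeta2_less_2: "zeta2 < 2"
  using infsum_le_finite_sums[OF summable_zeta2 sum_inverse_norm_square_bound]
  by (simp add: zeta2_def)

lemma sum_le_zeta2: "finite F \<Longrightarrow> F \<subseteq> nonzero_ideals \<Longrightarrow> (\<Sum>I\<in>F. 1 / (ideal_norm I)\<^sup>2) \<le> zeta2"
  unfolding zeta2_def by (rule finite_sum_le_infsum[OF summable_zeta2]) auto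

lemma zeta_Qi_2: "zeta_Qi 2 = complex_of_real zeta2"
proof -
  have "zeta_Qi 2 = (\<Sum>\<^sub>\<infinity>I\<in>nonzero_ideals. complex_of_real (1 / (ideal_norm I)\<^sup>2))"
    unfolding zeta_Qi_def
  proof (rule infsum_cong)
    fix I assume "I \<in> nonzero_ideals"
    then have pos: "ideal_norm I > 0" using ideal_norm_nonzero_ideal(2)[of I] by simp
    have "complex_of_real (ideal_norm I) powr (- 2) = complex_of_real (ideal_norm I) powr complex_of_real (- 2)"
      by simp
    also have "\<dots> = complex_of_real (ideal_norm I powr (- 2))"
      using pos by (intro powr_of_real) simp
    also have "ideal_norm I powr (- 2) = 1 / (ideal_norm I)\<^sup>2"
      using pos by (simp add: powr_minus_divide)
    finally show "complex_of_real (ideal_norm I) powr (- 2) = complex_of_real (1 / (ideal_norm I)\<^sup>2)" .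
  qed
  also have "\<dots> = complex_of_real zeta2"
    unfolding zeta2_def by (intro infsumI has_sum_of_real has_sum_infsum summable_zeta2)
  finally show ?thesis .
qed

section \<open>Inverting the convolution with the weights N(E)^-2\<close>

lemma unit_ideal:
  "gauss_PIdl 1 \<in> nonzero_ideals" "ideal_norm (gauss_PIdl 1) = 1"
  by (simp_all add: gauss_PIdl_nonzero_ideals ideal_norm_PIdl gauss_norm_def)

lemma ideal_norm_ge_2:
  assumes "I \<in> nonzero_ideals" "I \<noteq> gauss_PIdl 1"
  shows "ideal_norm I \<ge> 2"
proof (rule ccontr)
  assume "\<not> ideal_norm I \<ge> 2"
  moreover obtain m where "ideal_norm I = real m"
    using ideal_norm_nonzero_ideal(1)[OF assms(1)] by (metis Nats_cases)
  ultimately have 1: "ideal_norm I = 1" using ideal_norm_nonzero_ideal(2)[OF assms(1)] by simp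
  obtain \<eta> where \<eta>: "\<eta> \<in> gauss_int" "I = gauss_PIdl \<eta>" using assms(1) by (elim nonzero_idealsE)
  have "gauss_norm \<eta> = 1" using 1 \<eta> by (simp add: ideal_norm_PIdl)
  then have "\<eta> \<in> {1, -1, \<i>, -\<i>}" by (rule gauss_units[OF \<eta>(1)])
  then have "cnj \<eta> \<in> gauss_int" "1 = cnj \<eta> * \<eta>" by auto
  then have "1 \<in> gauss_PIdl \<eta>" unfolding gauss_PIdl_iff by blast
  moreover have "\<eta> \<in> gauss_PIdl 1" unfolding gauss_PIdl_iff using \<eta>(1) by auto
  ultimately have "I = gauss_PIdl 1" unfolding \<eta>(2) gauss_PIdl_eq_iff by blast
  with assms(2) show False ..
qed

lemma zeta2_ge_1: "zeta2 \<ge> 1"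
  using sum_le_zeta2[of "{gauss_PIdl 1}"] by (simp add: unit_ideal)

text \<open>The unit ideal contributes \<open>G x\<close> itself. The other ideals have total weight
  at most \<open>zeta2 - 1 < 1\<close> and evaluate \<open>G\<close> at arguments at most x / 2,
  where a bound is known inductively.\<close>

lemma zeta2_convolution_bounded_imp_bounded:
  fixes G :: "real \<Rightarrow> real"
  assumes B: "\<And>x. x \<ge> 1 \<Longrightarrow> \<bar>\<Sum>E\<in>ideals_upto x. G (x / ideal_norm E) / (ideal_norm E)\<^sup>2\<bar> \<le> B"
    and "x \<ge> 1"
  shows "\<bar>G x\<bar> \<le> B / (2 - zeta2)"
proof -
  \<comment> \<open>The fixed point of \<open>M = B + M * (zeta2 - 1)\<close>, so the bound
    reproduces itself in the induction.\<close>
  define M where "M = B / (2 - zeta2)"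
  have "B \<ge> 0" using B[of 1] by linarith
  then have M0: "M \<ge> 0" using zeta2_less_2 by (simp add: M_def)
  have M: "M = B + M * (zeta2 - 1)" using zeta2_less_2 by (simp add: M_def field_simps)
  \<comment> \<open>Dyadic induction: a norm of at least 2 moves the argument from below
    \<open>2 ^ Suc n\<close> to below \<open>2 ^ n\<close>. The base case is vacuous.\<close>
  have "\<bar>G y\<bar> \<le> M" if "1 \<le> y" "y < 2 ^ n" for y and n :: nat
    using that
  proof (induction n arbitrary: y)
    case (Suc n)
    let ?R = "gauss_PIdl 1"
    let ?U = "ideals_upto y - {?R}"
    have R: "?R \<in> ideals_upto y" using Suc.prems(1) by (simp add: ideals_upto_def unit_ideal)
    have "\<bar>G (y / ideal_norm E) / (ideal_norm E)\<^sup>2\<bar> \<le> M * (1 / (ideal_norm E)\<^sup>2)" if E: "E \<in> ?U" for E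
    proof -
      have nE: "2 \<le> ideal_norm E" "ideal_norm E \<le> y"
        using E ideal_norm_ge_2 by (auto simp: ideals_upto_def)
      have "y < 2 ^ n * 2" using Suc.prems(2) by simp
      also have "\<dots> \<le> 2 ^ n * ideal_norm E" using nE by (intro mult_left_mono) auto
      finally have "1 \<le> y / ideal_norm E" "y / ideal_norm E < 2 ^ n"
        using nE by (auto simp: field_simps)
      then have "\<bar>G (y / ideal_norm E)\<bar> \<le> M" by (rule Suc.IH)
      then have "\<bar>G (y / ideal_norm E)\<bar> / (ideal_norm E)\<^sup>2 \<le> M / (ideal_norm E)\<^sup>2"
        by (rule divide_right_mono) simp
      then show ?thesis by simp
    qed
    then have "\<bar>\<Sum>E\<in>?U. G (y / ideal_norm E) / (ideal_norm E)\<^sup>2\<bar> \<le> (\<Sum>E\<in>?U. M * (1 / (ideal_norm E)\<^sup>2))"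
      by (rule order_trans[OF sum_abs sum_mono])
    also have "\<dots> = M * (\<Sum>E\<in>?U. 1 / (ideal_norm E)\<^sup>2)" by (rule sum_distrib_left[symmetric])
    also have "\<dots> \<le> M * (zeta2 - 1)"
    proof (intro mult_left_mono M0)
      have "(\<Sum>E\<in>ideals_upto y. 1 / (ideal_norm E)\<^sup>2) \<le> zeta2"
        by (intro sum_le_zeta2 finite_ideals_upto) (auto simp: ideals_upto_def)
      then show "(\<Sum>E\<in>?U. 1 / (ideal_norm E)\<^sup>2) \<le> zeta2 - 1"
        using sum.remove[OF finite_ideals_upto R, of "\<lambda>E. 1 / (ideal_norm E)\<^sup>2"]
        by (simp add: unit_ideal)
    qed
    finally have "\<bar>\<Sum>E\<in>?U. G (y / ideal_norm E) / (ideal_norm E)\<^sup>2\<bar> \<le> M * (zeta2 - 1)" .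
    moreover have "(\<Sum>E\<in>ideals_upto y. G (y / ideal_norm E) / (ideal_norm E)\<^sup>2)
        = G y + (\<Sum>E\<in>?U. G (y / ideal_norm E) / (ideal_norm E)\<^sup>2)"
      using sum.remove[OF finite_ideals_upto R, of "\<lambda>E. G (y / ideal_norm E) / (ideal_norm E)\<^sup>2"]
      by (simp add: unit_ideal)
    ultimately show ?case using B[OF Suc.prems(1)] M by linarith
  qed simp
  moreover obtain n :: nat where "x < 2 ^ n" using real_arch_pow[of 2 x] by auto
  ultimately show ?thesis using assms(2) unfolding M_def by blast
qed

text \<open>Splitting ln (x / N) = ln x - ln N leaves two errors: the logarithmic series, at most
  40, and ln x times the tail of the zeta series, which the same series dominates.\<close>

lemma zeta2_convolution_ln:
  assumes "x \<ge> 1"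
  shows "\<bar>(\<Sum>E\<in>ideals_upto x. ln (x / ideal_norm E) / (ideal_norm E)\<^sup>2) - zeta2 * ln x\<bar> \<le> 80"
proof -
  let ?f = "\<lambda>I. 1 / (ideal_norm I)\<^sup>2" and ?g = "\<lambda>I. ln (ideal_norm I) / (ideal_norm I)\<^sup>2"
  have g0: "?g I \<ge> 0" if "I \<in> nonzero_ideals" for I
    using ideal_norm_nonzero_ideal(2)[OF that] by simp
  have g40: "(\<Sum>I\<in>F. ?g I) \<le> 40" if F: "finite F" "F \<subseteq> nonzero_ideals" for F
  proof -
    have "(\<Sum>I\<in>F. ?g I) \<le> (\<Sum>I\<in>F. 2 * (1 / (ideal_norm I * sqrt (ideal_norm I))))"
    proof (intro sum_mono ln_div_square_le)
      fix I assume "I \<in> F"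
      then show "ideal_norm I > 0" using F(2) ideal_norm_nonzero_ideal(2)[of I] by auto
    qed
    then show ?thesis
      using sum_inverse_norm_sqrt_bound_finite[OF F] unfolding sum_distrib_left[symmetric] by linarith
  qed
  have sub: "ideals_upto x \<subseteq> nonzero_ideals" by (auto simp: ideals_upto_def)
  have ln0: "ln x \<ge> 0" using assms by simp
  have eq: "(\<Sum>E\<in>ideals_upto x. ln (x / ideal_norm E) / (ideal_norm E)\<^sup>2)
      = ln x * sum ?f (ideals_upto x) - sum ?g (ideals_upto x)"
    unfolding sum_distrib_left sum_subtractf[symmetric]
  proof (rule sum.cong[OF refl])
    fix E assume "E \<in> ideals_upto x"
    then have "ideal_norm E > 0" by (rule ideal_norm_pos)
    then show "ln (x / ideal_norm E) / (ideal_norm E)\<^sup>2 = ln x * ?f E - ?g E"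
      using assms by (simp add: ln_div diff_divide_distrib)
  qed
  have upper: "ln x * sum ?f (ideals_upto x) \<le> ln x * zeta2"
    by (intro mult_left_mono ln0 sum_le_zeta2 finite_ideals_upto sub)
  have lower: "zeta2 * ln x \<le> ln x * sum ?f (ideals_upto x) + 40"
  proof (cases "ln x = 0")
    case False
    with ln0 have lnp: "ln x > 0" by simp
    \<comment> \<open>It suffices to bound finite sums. Their part beyond \<open>x\<close>,
      multiplied by \<open>ln x\<close>, is at most a sum of \<open>?g\<close>, because there ln x
      \<le> ln N(I).\<close>
    have "zeta2 \<le> sum ?f (ideals_upto x) + 40 / ln x"
      unfolding zeta2_def
    proof (rule infsum_le_finite_sums[OF summable_zeta2])
      fix F assume F: "finite F" "F \<subseteq> nonzero_ideals"
      have "ln x * sum ?f (F - ideals_upto x) \<le> sum ?g (F - ideals_upto x)"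
        unfolding sum_distrib_left
      proof (rule sum_mono)
        fix I assume "I \<in> F - ideals_upto x"
        then have "x \<le> ideal_norm I" using F(2) by (auto simp: ideals_upto_def)
        then have "ln x \<le> ln (ideal_norm I)" using assms by simp
        then show "ln x * ?f I \<le> ?g I" by (simp add: divide_right_mono)
      qed
      also have "\<dots> \<le> 40" using F by (intro g40) auto
      finally have "sum ?f (F - ideals_upto x) \<le> 40 / ln x" using lnp by (simp add: field_simps)
      moreover have "sum ?f F = sum ?f (F \<inter> ideals_upto x) + sum ?f (F - ideals_upto x)"
        by (rule sum.Int_Diff[OF F(1)])
      moreover have "sum ?f (F \<inter> ideals_upto x) \<le> sum ?f (ideals_upto x)"
        by (intro sum_mono2 finite_ideals_upto) auto
      ultimately show "sum ?f F \<le> sum ?f (ideals_upto x) + 40 / ln x" by linarith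
    qed
    then have "zeta2 * ln x \<le> (sum ?f (ideals_upto x) + 40 / ln x) * ln x"
      by (rule mult_right_mono[OF _ ln0])
    also have "\<dots> = ln x * sum ?f (ideals_upto x) + 40" using lnp by (simp add: field_simps)
    finally show ?thesis .
  qed simp
  have "0 \<le> sum ?g (ideals_upto x)" using g0 sub by (intro sum_nonneg) auto
  moreover have "sum ?g (ideals_upto x) \<le> 40" by (intro g40 finite_ideals_upto sub)
  ultimately show ?thesis
    using upper lower unfolding eq mult.commute[of zeta2] by linarith
qed

section \<open>The convolution identity and the asymptotics of the sum\<close>

definition gcd_norm_sum :: "real \<Rightarrow> real" where
  "gcd_norm_sum x = (\<Sum>I\<in>ideals_upto x. \<Sum>J\<in>ideals_upto x. ideal_norm (ideal_gcd I J))"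

text \<open>\<open>gcd_swap\<close> maps \<open>T\<close> to itself because it preserves both
  products N(E) N(I) and N(E) N(J). Reindexing by it replaces the norm of the gcd by that of
  \<open>E\<close>, after which the inner sums only count pairs.\<close>

lemma gcd_norm_sum_convolution:
  "(\<Sum>E\<in>ideals_upto x. gcd_norm_sum (x / ideal_norm E)) =
   (\<Sum>E\<in>ideals_upto x. ideal_norm E * (real (card (ideals_upto (x / ideal_norm E))))\<^sup>2)"
proof -
  define T where "T = (SIGMA E:ideals_upto x. ideals_upto (x / ideal_norm E) \<times> ideals_upto (x / ideal_norm E))"
  have swap: "gcd_swap p \<in> T \<and> gcd_swap (gcd_swap p) = p \<and>
      ideal_norm (fst (gcd_swap p)) = (\<lambda>(E, I, J). ideal_norm (ideal_gcd I J)) p" if "p \<in> T" for p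
  proof -
    obtain E I J where p: "p = (E, I, J)" by (cases p)
    have EIJ: "E \<in> nonzero_ideals" "I \<in> nonzero_ideals" "J \<in> nonzero_ideals"
      and nE: "ideal_norm E > 0" and "ideal_norm I \<le> x / ideal_norm E" "ideal_norm J \<le> x / ideal_norm E"
      using that ideal_norm_pos[of E] by (auto simp: p T_def ideals_upto_def)
    then have le: "ideal_norm E * ideal_norm I \<le> x" "ideal_norm E * ideal_norm J \<le> x"
      by (simp_all add: field_simps)
    obtain I' J' where *: "gcd_swap (E, I, J) = (ideal_gcd I J, I', J')"
      "gcd_swap (ideal_gcd I J, I', J') = (E, I, J)" "ideal_gcd I J \<in> nonzero_ideals"
      "I' \<in> nonzero_ideals" "J' \<in> nonzero_ideals"
      "ideal_norm E * ideal_norm I = ideal_norm (ideal_gcd I J) * ideal_norm I'"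
      "ideal_norm E * ideal_norm J = ideal_norm (ideal_gcd I J) * ideal_norm J'"
      using gcd_swap_involution[OF EIJ] by metis
    let ?d = "ideal_norm (ideal_gcd I J)"
    have d: "?d \<ge> 1" "ideal_norm I' \<ge> 1"
      using *(3,4) by (simp_all add: ideal_norm_nonzero_ideal(2))
    \<comment> \<open>The gcd must itself have norm at most \<open>x\<close>: N(D) \<le> N(D) N(I')
      = N(E) N(I) \<le> x.\<close>
    have "?d * 1 \<le> ?d * ideal_norm I'" using d by (intro mult_left_mono) auto
    then have "?d \<le> x" using le(1) *(6) by linarith
    moreover have "ideal_norm I' \<le> x / ?d" "ideal_norm J' \<le> x / ?d"
      using le d unfolding *(6,7) by (simp_all add: field_simps)
    ultimately have "(ideal_gcd I J, I', J') \<in> T"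
      using *(3-5) by (simp add: T_def ideals_upto_def)
    then show ?thesis unfolding p *(1) *(2) by simp
  qed
  have "(\<Sum>E\<in>ideals_upto x. gcd_norm_sum (x / ideal_norm E)) = (\<Sum>(E, I, J)\<in>T. ideal_norm (ideal_gcd I J))"
    unfolding T_def gcd_norm_sum_def sum.cartesian_product
    by (subst sum.Sigma) (auto simp: finite_ideals_upto case_prod_beta)
  also have "\<dots> = (\<Sum>(E, I, J)\<in>T. ideal_norm E)"
    by (rule sum.reindex_bij_witness[where i = gcd_swap and j = gcd_swap])
      (use swap in \<open>auto simp: case_prod_beta\<close>)
  also have "\<dots> = (\<Sum>E\<in>ideals_upto x. \<Sum>(I, J)\<in>ideals_upto (x / ideal_norm E) \<times> ideals_upto (x / ideal_norm E). ideal_norm E)"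
    unfolding T_def by (subst sum.Sigma) (auto simp: finite_ideals_upto case_prod_beta)
  also have "\<dots> = (\<Sum>E\<in>ideals_upto x. ideal_norm E * (real (card (ideals_upto (x / ideal_norm E))))\<^sup>2)"
    by (intro sum.cong refl) (simp add: case_prod_beta card_cartesian_product power2_eq_square)
  finally show ?thesis .
qed

text \<open>Difference of two squares: the factor 4 sqrt y bounds the difference, and 5 y + y bounds
  the sum.\<close>

lemma card_ideals_upto_square:
  assumes "y \<ge> 1"
  shows "\<bar>(real (card (ideals_upto y)))\<^sup>2 - (pi / 4 * y)\<^sup>2\<bar> \<le> 24 * (y * sqrt y)"
proof -
  let ?A = "real (card (ideals_upto y))"
  have "pi / 4 * y \<le> 1 * y" using pi_less_4 assms by (intro mult_right_mono) auto
  moreover have "?A \<le> 5 * y" using card_ideals_upto_le[of y] assms by simp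
  moreover have "pi / 4 * y \<ge> 0" using assms by simp
  ultimately have "\<bar>?A + pi / 4 * y\<bar> \<le> 6 * y" by linarith
  then have "\<bar>?A - pi / 4 * y\<bar> * \<bar>?A + pi / 4 * y\<bar> \<le> (4 * sqrt y) * (6 * y)"
    using card_ideals_upto[OF assms] assms by (intro mult_mono) auto
  moreover have "?A\<^sup>2 - (pi / 4 * y)\<^sup>2 = (?A - pi / 4 * y) * (?A + pi / 4 * y)"
    by (simp add: power2_eq_square algebra_simps)
  ultimately show ?thesis by (simp add: abs_mult mult_ac)
qed

lemma sum_inverse_norm_bound_real:
  assumes "x \<ge> 1"
  shows "\<bar>(\<Sum>I\<in>ideals_upto x. 1 / ideal_norm I) - pi / 4 * ln x\<bar> \<le> 31"
proof -
  define n where "n = nat \<lfloor>x\<rfloor>"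
  have n: "n > 0" "real n \<le> x" "x \<le> real n + 1"
    using assms by (auto simp: n_def)
  have U: "ideals_upto x = ideals_upto (real n)"
    unfolding n_def using assms by (intro ideals_upto_floor) simp
  have "ln x - ln (real n) = ln (x / real n)" using assms n by (simp add: ln_div)
  also have "\<dots> \<le> x / real n - 1" using assms n by (intro ln_le_minus_one) simp
  also have "\<dots> \<le> 1" using n by (simp add: field_simps)
  finally have "ln x - ln (real n) \<le> 1" .
  moreover have "ln (real n) \<le> ln x" using n by simp
  ultimately have "\<bar>pi / 4 * (ln x - ln (real n))\<bar> \<le> 1 * 1"
    unfolding abs_mult using pi_less_4 by (intro mult_mono) auto
  then show ?thesis
    using sum_inverse_norm_bound[OF n(1)] unfolding U right_diff_distrib by linarith
qed

text \<open>Inserting the count turns each summand into (pi/4)^2 x^2 / N(E) with error 24 x^(3/2) /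
  sqrt N(E). These errors add up to at most 240 x^2, and evaluating the sum of 1 / N(E) costs
  another 31 x^2.\<close>

lemma sum_norm_card_square_bound:
  assumes "x \<ge> 1"
  shows "\<bar>(\<Sum>E\<in>ideals_upto x. ideal_norm E * (real (card (ideals_upto (x / ideal_norm E))))\<^sup>2)
     - (pi / 4) ^ 3 * x\<^sup>2 * ln x\<bar> \<le> 271 * x\<^sup>2"
proof -
  let ?A = "\<lambda>y. real (card (ideals_upto y))"
  let ?c = "pi / 4"
  define n where "n = nat \<lfloor>x\<rfloor>"
  have n: "real n \<le> x" "ideals_upto x = ideals_upto (real n)"
    unfolding n_def using assms ideals_upto_floor[of x] by auto
  have summand_bound: "\<bar>ideal_norm E * (?A (x / ideal_norm E))\<^sup>2 - ?c\<^sup>2 * x\<^sup>2 * (1 / ideal_norm E)\<bar>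
      \<le> 24 * (x * sqrt x) * (1 / sqrt (ideal_norm E))" if "E \<in> ideals_upto x" for E
  proof -
    let ?N = "ideal_norm E"
    have N: "?N > 0" "?N \<le> x" using that ideal_norm_pos[OF that] by (auto simp: ideals_upto_def)
    have "\<bar>?N * ((?A (x / ?N))\<^sup>2 - (?c * (x / ?N))\<^sup>2)\<bar> = ?N * \<bar>(?A (x / ?N))\<^sup>2 - (?c * (x / ?N))\<^sup>2\<bar>"
      using N by (simp add: abs_mult)
    also have "\<dots> \<le> ?N * (24 * (x / ?N * sqrt (x / ?N)))"
      using N by (intro mult_left_mono card_ideals_upto_square) auto
    also have "\<dots> = 24 * (x * sqrt x) * (1 / sqrt ?N)"
      using N by (simp add: real_sqrt_divide)
    also have "?N * ((?A (x / ?N))\<^sup>2 - (?c * (x / ?N))\<^sup>2) = ?N * (?A (x / ?N))\<^sup>2 - ?c\<^sup>2 * x\<^sup>2 * (1 / ?N)"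
      using N by (simp add: right_diff_distrib power_mult_distrib power_divide) (simp add: power2_eq_square)
    finally show ?thesis .
  qed
  have "\<bar>(\<Sum>E\<in>ideals_upto x. ideal_norm E * (?A (x / ideal_norm E))\<^sup>2)
      - (\<Sum>E\<in>ideals_upto x. ?c\<^sup>2 * x\<^sup>2 * (1 / ideal_norm E))\<bar>
      \<le> (\<Sum>E\<in>ideals_upto x. 24 * (x * sqrt x) * (1 / sqrt (ideal_norm E)))"
    unfolding sum_subtractf[symmetric] by (rule order_trans[OF sum_abs sum_mono[OF summand_bound]])
  also have "\<dots> = 24 * (x * sqrt x) * (\<Sum>E\<in>ideals_upto (real n). 1 / sqrt (ideal_norm E))"
    unfolding n(2) by (rule sum_distrib_left[symmetric])
  also have "\<dots> \<le> 24 * (x * sqrt x) * (10 * sqrt x)"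
  proof (rule mult_left_mono)
    have "10 * sqrt (real n) \<le> 10 * sqrt x" using n by simp
    then show "(\<Sum>E\<in>ideals_upto (real n). 1 / sqrt (ideal_norm E)) \<le> 10 * sqrt x"
      using sum_inverse_sqrt_norm_bound[of n] by linarith
  qed (use assms in simp)
  also have "\<dots> = 240 * x\<^sup>2"
    using assms by (simp add: power2_eq_square)
  finally have 1: "\<bar>(\<Sum>E\<in>ideals_upto x. ideal_norm E * (?A (x / ideal_norm E))\<^sup>2)
      - ?c\<^sup>2 * x\<^sup>2 * (\<Sum>E\<in>ideals_upto x. 1 / ideal_norm E)\<bar> \<le> 240 * x\<^sup>2"
    unfolding sum_distrib_left .
  have "?c\<^sup>2 \<le> 1" using pi_less_4 by (simp add: power_le_one)
  then have "\<bar>?c\<^sup>2 * x\<^sup>2 * ((\<Sum>E\<in>ideals_upto x. 1 / ideal_norm E) - ?c * ln x)\<bar> \<le> 1 * x\<^sup>2 * 31"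
    unfolding abs_mult using sum_inverse_norm_bound_real[OF assms]
    by (intro mult_mono) auto
  moreover have "?c\<^sup>2 * x\<^sup>2 * ((\<Sum>E\<in>ideals_upto x. 1 / ideal_norm E) - ?c * ln x)
     = ?c\<^sup>2 * x\<^sup>2 * (\<Sum>E\<in>ideals_upto x. 1 / ideal_norm E) - ?c ^ 3 * x\<^sup>2 * ln x"
    unfolding right_diff_distrib by (simp add: power2_eq_square power3_eq_cube mult_ac)
  \<comment> \<open>The triangle inequality is proved for plain variables, so that linear arithmetic
    does not meet the large nonlinear terms.\<close>
  moreover have "\<bar>p - r\<bar> \<le> 271 * y" if "\<bar>d\<bar> \<le> 1 * y * 31" "d = q - r" "\<bar>p - q\<bar> \<le> 240 * y"
    for p q r d y :: real
    using that by linarith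
  ultimately show ?thesis using 1 by blast
qed

text \<open>\<open>G\<close> is the normalised remainder. In its convolution the main terms cancel,
  since \<open>\<kappa> * zeta2\<close> equals the constant (pi/4)^3 of the evaluated sum; so the
  convolution is bounded, and by the inversion \<open>G\<close> is too.\<close>

lemma gcd_norm_sum_asymp:
  obtains M where "\<And>x. x \<ge> 1 \<Longrightarrow> \<bar>gcd_norm_sum x - (pi / 4) ^ 3 / zeta2 * x\<^sup>2 * ln x\<bar> \<le> M * x\<^sup>2"
proof -
  define \<kappa> where "\<kappa> = (pi / 4) ^ 3 / zeta2"
  have \<kappa>: "\<kappa> \<ge> 0" "\<kappa> * zeta2 = (pi / 4) ^ 3" using zeta2_ge_1 by (auto simp: \<kappa>_def)
  define G where "G = (\<lambda>x. gcd_norm_sum x / x\<^sup>2 - \<kappa> * ln x)"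
  have "\<bar>\<Sum>E\<in>ideals_upto x. G (x / ideal_norm E) / (ideal_norm E)\<^sup>2\<bar> \<le> 271 + \<kappa> * 80" if x: "x \<ge> 1" for x
  proof -
    have "G (x / ideal_norm E) / (ideal_norm E)\<^sup>2 = gcd_norm_sum (x / ideal_norm E) / x\<^sup>2
       - \<kappa> * (ln (x / ideal_norm E) / (ideal_norm E)\<^sup>2)" if "E \<in> ideals_upto x" for E
      using ideal_norm_pos[OF that] x by (simp add: G_def power_divide diff_divide_distrib)
    then have eq: "(\<Sum>E\<in>ideals_upto x. G (x / ideal_norm E) / (ideal_norm E)\<^sup>2) =
      (\<Sum>E\<in>ideals_upto x. gcd_norm_sum (x / ideal_norm E)) / x\<^sup>2
       - \<kappa> * (\<Sum>E\<in>ideals_upto x. ln (x / ideal_norm E) / (ideal_norm E)\<^sup>2)" (is "_ = ?S / x\<^sup>2 - \<kappa> * ?L")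
      by (simp add: sum_subtractf sum_divide_distrib sum_distrib_left)
    have "\<bar>?S - (pi / 4) ^ 3 * x\<^sup>2 * ln x\<bar> / x\<^sup>2 \<le> 271 * x\<^sup>2 / x\<^sup>2"
      unfolding gcd_norm_sum_convolution by (intro divide_right_mono sum_norm_card_square_bound x) simp
    then have "\<bar>(?S - (pi / 4) ^ 3 * x\<^sup>2 * ln x) / x\<^sup>2\<bar> \<le> 271" using x by simp
    moreover have "(?S - (pi / 4) ^ 3 * x\<^sup>2 * ln x) / x\<^sup>2 = ?S / x\<^sup>2 - \<kappa> * (zeta2 * ln x)"
      using x by (simp add: diff_divide_distrib flip: \<kappa>(2))
    moreover have "\<bar>\<kappa> * (?L - zeta2 * ln x)\<bar> \<le> \<kappa> * 80"
      unfolding abs_mult using \<kappa>(1) zeta2_convolution_ln[OF x] by (intro mult_mono) auto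
    ultimately show ?thesis unfolding eq right_diff_distrib[of \<kappa>] by linarith
  qed
  then have G: "\<bar>G x\<bar> \<le> (271 + \<kappa> * 80) / (2 - zeta2)" if "x \<ge> 1" for x
    using that by (rule zeta2_convolution_bounded_imp_bounded)
  show thesis
  proof (rule that)
    fix x :: real assume x: "x \<ge> 1"
    have "\<bar>G x\<bar> * x\<^sup>2 \<le> (271 + \<kappa> * 80) / (2 - zeta2) * x\<^sup>2" by (intro mult_right_mono G x) simp
    moreover have "\<bar>G x\<bar> * x\<^sup>2 = \<bar>G x * x\<^sup>2\<bar>" by (simp add: abs_mult)
    moreover have "G x * x\<^sup>2 = gcd_norm_sum x - \<kappa> * x\<^sup>2 * ln x"
      using x by (simp add: G_def left_diff_distrib)
    ultimately show "\<bar>gcd_norm_sum x - (pi / 4) ^ 3 / zeta2 * x\<^sup>2 * ln x\<bar> \<le> (271 + \<kappa> * 80) / (2 - zeta2) * x\<^sup>2"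
      unfolding \<kappa>_def[symmetric] by linarith
  qed
qed

section \<open>From the sum to the expected value\<close>

lemma pair_pmf_of_set:
  assumes "finite A" "A \<noteq> {}" "finite B" "B \<noteq> {}"
  shows "pair_pmf (pmf_of_set A) (pmf_of_set B) = pmf_of_set (A \<times> B)"
proof (rule pmf_eqI)
  fix p :: "'a \<times> 'b"
  obtain a b where p: "p = (a, b)" by (cases p)
  have "pmf (pair_pmf (pmf_of_set A) (pmf_of_set B)) (a, b) =
      (indicator A a / real (card A)) * (indicator B b / real (card B))"
    unfolding pmf_pair by (simp only: pmf_of_set assms not_False_eq_True)
  also have "\<dots> = indicator (A \<times> B) (a, b) / real (card (A \<times> B))"
    by (simp only: indicator_times card_cartesian_product of_nat_mult times_divide_times_eq fst_conv snd_conv)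
  also have "\<dots> = pmf (pmf_of_set (A \<times> B)) (a, b)"
    using assms by (intro pmf_of_set[symmetric]) auto
  finally show "pmf (pair_pmf (pmf_of_set A) (pmf_of_set B)) p = pmf (pmf_of_set (A \<times> B)) p"
    unfolding p .
qed

lemma expected_gcd_norm_eq:
  assumes "x \<ge> 1"
  shows "expected_gcd_norm x = gcd_norm_sum x / (real (card (ideals_upto x)))\<^sup>2"
proof -
  have ne: "ideals_upto x \<noteq> {}"
    using assms unit_ideal by (auto simp: ideals_upto_def)
  show ?thesis
    unfolding expected_gcd_norm_def pair_pmf_of_set[OF finite_ideals_upto ne finite_ideals_upto ne]
    using ne finite_ideals_upto
    by (subst integral_pmf_of_set)
      (simp_all add: gcd_norm_sum_def sum.cartesian_product card_cartesian_product power2_eq_square)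
qed

theorem theorem2:
  "(\<lambda>x::real. complex_of_real (expected_gcd_norm x)
      - complex_of_real pi / (4 * zeta_Qi 2) * complex_of_real (ln x)) \<in> O[at_top](\<lambda>_. 1)"
proof -
  obtain M where M: "\<And>x. x \<ge> 1 \<Longrightarrow> \<bar>gcd_norm_sum x - (pi / 4) ^ 3 / zeta2 * x\<^sup>2 * ln x\<bar> \<le> M * x\<^sup>2"
    using gcd_norm_sum_asymp by blast
  \<comment> \<open>The constant of \<open>gcd_norm_sum\<close> divided by the square of the density
    pi/4 of the ideals.\<close>
  define \<mu> where "\<mu> = pi / (4 * zeta2)"
  have \<mu>: "\<mu> \<ge> 0" using zeta2_ge_1 by (simp add: \<mu>_def)
  \<comment> \<open>From 256 on, sqrt x \<ge> 16 makes the counting error 4 sqrt x at most x / 4,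
    and pi/4 \<ge> 1/2 leaves a count of at least x / 4; its square gives the factor 16.\<close>
  have bound: "\<bar>expected_gcd_norm x - \<mu> * ln x\<bar> \<le> 16 * (M + \<mu> * 48)" if x: "x \<ge> 256" for x
  proof -
    let ?A = "real (card (ideals_upto x))"
    have x1: "x \<ge> 1" using x by simp
    have "16 * sqrt x \<le> sqrt x * sqrt x"
      using x by (intro mult_right_mono real_le_rsqrt) auto
    then have "4 * sqrt x \<le> x / 4" using x by simp
    moreover have "1/2 * x \<le> pi / 4 * x" using pi_ge_two x by (intro mult_right_mono) auto
    ultimately have A: "?A \<ge> x / 4" using card_ideals_upto[OF x1] by linarith
    then have Apos: "?A > 0" using x by linarith
    have "(x / 4)\<^sup>2 \<le> ?A\<^sup>2" using A x by (intro power_mono) auto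
    then have A2: "x\<^sup>2 \<le> 16 * ?A\<^sup>2" by (simp add: power_divide)
    \<comment> \<open>With ln x \<le> 2 sqrt x, replacing (pi/4 x)^2 by the squared count in the
      main term costs only a multiple of x^2: the error x^(3/2) absorbs the logarithm.\<close>
    have "ln (sqrt x) \<le> sqrt x" using x1 ln_le_minus_one[of "sqrt x"] by simp
    then have "ln x \<le> 2 * sqrt x" using x by (simp add: ln_sqrt)
    moreover have "ln x \<ge> 0" using x1 by simp
    ultimately have "\<bar>\<mu> * ln x * (?A\<^sup>2 - (pi / 4 * x)\<^sup>2)\<bar> \<le> \<mu> * (2 * sqrt x) * (24 * (x * sqrt x))"
      unfolding abs_mult using \<mu> x1 card_ideals_upto_square[OF x1] by (intro mult_mono) auto
    also have "\<dots> = \<mu> * 48 * x\<^sup>2" using x1 by (simp add: power2_eq_square)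
    finally have 1: "\<bar>\<mu> * ln x * (?A\<^sup>2 - (pi / 4 * x)\<^sup>2)\<bar> \<le> \<mu> * 48 * x\<^sup>2" .
    have eq: "(pi / 4) ^ 3 / zeta2 * x\<^sup>2 * ln x = \<mu> * ln x * (pi / 4 * x)\<^sup>2"
      by (simp add: \<mu>_def power2_eq_square power3_eq_cube)
    have "\<bar>gcd_norm_sum x - \<mu> * ln x * ?A\<^sup>2\<bar> \<le> (M + \<mu> * 48) * x\<^sup>2"
    proof -
      have "\<bar>s - q\<bar> \<le> m + n" if "\<bar>s - p\<bar> \<le> m" "\<bar>q - p\<bar> \<le> n" for s p q m n :: real
        using that by linarith
      from this[of "gcd_norm_sum x" "\<mu> * ln x * (pi / 4 * x)\<^sup>2" "M * x\<^sup>2" "\<mu> * ln x * ?A\<^sup>2" "\<mu> * 48 * x\<^sup>2"]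
      show ?thesis
        using M[OF x1] 1 unfolding eq right_diff_distrib distrib_right by blast
    qed
    also have "\<dots> \<le> (M + \<mu> * 48) * (16 * ?A\<^sup>2)"
    proof (intro mult_left_mono A2)
      have "M \<ge> 0" using M[of 1] by simp
      with \<mu> show "M + \<mu> * 48 \<ge> 0" by simp
    qed
    finally have "\<bar>gcd_norm_sum x - \<mu> * ln x * ?A\<^sup>2\<bar> / ?A\<^sup>2 \<le> 16 * (M + \<mu> * 48)"
      using Apos by (simp add: field_simps)
    moreover have "\<bar>gcd_norm_sum x - \<mu> * ln x * ?A\<^sup>2\<bar> / ?A\<^sup>2 = \<bar>(gcd_norm_sum x - \<mu> * ln x * ?A\<^sup>2) / ?A\<^sup>2\<bar>"
      by simp
    moreover have "(gcd_norm_sum x - \<mu> * ln x * ?A\<^sup>2) / ?A\<^sup>2 = expected_gcd_norm x - \<mu> * ln x"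
      using Apos by (simp add: expected_gcd_norm_eq[OF x1] diff_divide_distrib)
    ultimately show ?thesis by simp
  qed
  show ?thesis
  proof (rule bigoI[of _ "16 * (M + \<mu> * 48)"])
    have eq: "complex_of_real (expected_gcd_norm x) - complex_of_real pi / (4 * zeta_Qi 2) * complex_of_real (ln x)
       = complex_of_real (expected_gcd_norm x - \<mu> * ln x)" for x
      by (simp add: zeta_Qi_2 \<mu>_def)
    show "\<forall>\<^sub>F x in at_top. norm (complex_of_real (expected_gcd_norm x)
        - complex_of_real pi / (4 * zeta_Qi 2) * complex_of_real (ln x)) \<le> 16 * (M + \<mu> * 48) * norm (1::complex)"
      unfolding eq norm_of_real using eventually_ge_at_top[of "256::real"]
      by eventually_elim (use bound in simp)
  qed
qed

end
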